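(* Let $K$ be a virtual link diagram, let $G$ be its face graph, with each classical crossing giving a regular edge colored $+$ or $-$ and each virtual crossing giving a zero edge, and let $\mathcal{H}$ be the set of zero edges. Let $T_\mathcal{H}(G)$ be the relative Tutte polynomial with $\psi(\mathcal{H}_\mathcal{C})=d^{|\mathcal{H}_\mathcal{C}|_0-1}$. Then under the substitution $X_+\mapsto -A^{-3}$, $X_-\mapsto -A^{3}$, $Y_+\mapsto -A^{3}$, $Y_-\mapsto -A^{-3}$, $x_+\mapsto A$, $x_-\mapsto A^{-1}$, $y_+\mapsto A^{-1}$, $y_-\mapsto A$, $d\mapsto -(A^2+A^{-2})$, the polynomial $T_\mathcal{H}(G)$ becomes the Kauffman bracket $\langle K\rangle\in\mathbb{Z}[A,A^{-1}]$.
   Context: A virtual link diagram is a finite collection of closed curves generically immersed in the plane whose double points (crossings) are each either classical (with over/under information) or virtual. Treating all crossings as vertices of a $4$-valent plane graph, shade the complementary regions checkerboard-fashion with the unbounded region white. The face graph $G$ has a vertex for each dark region and, for each crossing, an edge joining the two dark regions meeting diagonally at that crossing (possibly a loop). At a classical crossing, the A-regions are the two opposite corners swept when the over-strand is rotated counterclockwise, the B-regions the other two; the A-smoothing merges the two A-regions, the B-smoothing the two B-regions. A classical-crossing edge is colored $+$ if the dark regions at the crossing are its A-regions and $-$ if they are its B-regions; virtual-crossing edges are zero edges. Kauffman bracket: $\langle K\rangle=\sum_s A^{a(s)-b(s)}d^{|s|-1}$ with $d=-A^2-A^{-2}$, summed over all ways $s$ of choosing an A- or B-smoothing at every classical crossing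 (virtual crossings left unchanged), $a(s),b(s)$ the numbers of A- and B-smoothings, and $|s|$ the number of closed curves in the result. Relative Tutte polynomial: cycles are edge sets of circuits (loops included), cocycles are minimal edge sets whose removal increases the number of connected components; a contracting set is $\mathcal{C}\subseteq E(G)\setminus\mathcal{H}$ containing no cycle such that $\mathcal{D}=E(G)\setminus(\mathcal{C}\cup\mathcal{H})$ contains no cocycle; $\mathcal{H}_\mathcal{C}$ is $G$ with $\mathcal{D}$ deleted and $\mathcal{C}$ contracted, which is the face graph of the diagram obtained from $K$ by smoothing each classical crossing of $\mathcal{C}$ so as to merge its dark regions and each of $\mathcal{D}$ the other way, and $|\mathcal{H}_\mathcal{C}|_0$ (zero order) is the number of components of that diagram. Choose a proper labeling $\phi$ ($0$ on $\mathcal{H}$, injective into positive integers on regular edges). For $e\in\mathcal{C}$: internally active if $\mathcal{D}\cup\{e\}$ contains a cocycle in which $e$ has the smallest label; for $f\in\mathcal{D}$: externally active if $\mathcal{C}\cup\{f\}$ contains a cycle in which $f$ has the smallest label. A regular edge of color $\lambda\in\{+,-\}$ has weight $X_\lambda,x_\lambda,Y_\lambda,y_\lambda$ according as it is internally active, internally inactive, externally active, externally inactive. $T_\mathcal{H}(G)=\sum_\mathcal{C}\big(\prod_{e\notin\mathcal{H}}w(e)\big)\psi(\mathcal{H}_\mathcal{C})\in\mathbb{Z}[d][X_\pm,Y_\pm,x_\pm,y_\pm]$; its image under the substitution does not depend on $\phi$. *)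

theory Defs
  imports "HOL-Library.Poly_Mapping" "HOL-Combinatorics.Orbits"
begin

section \<open>Polynomial rings\<close>

text \<open>
  A finitely supported function on a monoid of exponents is an element of the monoid ring:
  \<open>int \<Rightarrow>\<^sub>0 int\<close> is the ring of integral Laurent polynomials in one variable \<open>A\<close>, and
  \<open>('v \<Rightarrow>\<^sub>0 nat) \<Rightarrow>\<^sub>0 int\<close> is the integral polynomial ring in the variables \<open>'v\<close>.
\<close>

type_synonym laurent = "int \<Rightarrow>\<^sub>0 int"
type_synonym 'v mpoly = "('v \<Rightarrow>\<^sub>0 nat) \<Rightarrow>\<^sub>0 int"

definition A_pow :: "int \<Rightarrow> laurent" where
  "A_pow k = Poly_Mapping.single k 1"

definition mvar :: "'v \<Rightarrow> 'v mpoly" where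
  "mvar v = Poly_Mapping.single (Poly_Mapping.single v 1) 1"

definition substitute :: "('v \<Rightarrow> 'a::comm_ring_1) \<Rightarrow> 'v mpoly \<Rightarrow> 'a" where
  "substitute \<rho> p = (\<Sum>m\<in>Poly_Mapping.keys p.
     of_int (Poly_Mapping.lookup p m) *
     (\<Prod>v\<in>Poly_Mapping.keys m. \<rho> v ^ Poly_Mapping.lookup m v))"


section \<open>Multigraphs\<close>

text \<open>The classes, inside \<open>V\<close>, of the equivalence relation generated by \<open>R \<subseteq> V \<times> V\<close>.\<close>

definition connected_classes :: "'a set \<Rightarrow> ('a \<times> 'a) set \<Rightarrow> 'a set set" where
  "connected_classes V R = V // (R \<union> R\<inverse>)\<^sup>*"

text \<open>Loops are the edges \<open>e\<close> with \<open>ends e\<close> a singleton; parallel edges are allowed.\<close>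

record ('v, 'e) multigraph =
  verts :: "'v set"
  edges :: "'e set"
  ends :: "'e \<Rightarrow> 'v set"

definition num_components :: "('v, 'e) multigraph \<Rightarrow> 'e set \<Rightarrow> nat" where
  "num_components G F = card (connected_classes (verts G)
     {(u, v). u \<in> verts G \<and> v \<in> verts G \<and> (\<exists>e\<in>F. ends G e = {u, v})})"

definition is_cycle :: "('v, 'e) multigraph \<Rightarrow> 'e set \<Rightarrow> bool" where
  "is_cycle G F \<longleftrightarrow> (\<exists>vs es. es \<noteq> [] \<and> length vs = length es \<and> distinct vs \<and> distinct es \<and>
     set vs \<subseteq> verts G \<and> set es \<subseteq> edges G \<and>
     (\<forall>i<length es. ends G (es ! i) = {vs ! i, vs ! (Suc i mod length es)}) \<and>
     F = set es)"

definition separating :: "('v, 'e) multigraph \<Rightarrow> 'e set \<Rightarrow> bool" where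
  "separating G F \<longleftrightarrow>
     F \<subseteq> edges G \<and> num_components G (edges G - F) > num_components G (edges G)"

definition is_cocycle :: "('v, 'e) multigraph \<Rightarrow> 'e set \<Rightarrow> bool" where
  "is_cocycle G F \<longleftrightarrow> separating G F \<and> (\<forall>F'. F' \<subset> F \<longrightarrow> \<not> separating G F')"

definition is_tree :: "('v, 'e) multigraph \<Rightarrow> bool" where
  "is_tree G \<longleftrightarrow> num_components G (edges G) = 1 \<and> (\<nexists>F. is_cycle G F)"


section \<open>The relative Tutte polynomial\<close>

datatype sign = Plus | Minus

datatype tutte_var =
    X_act sign    \<comment> \<open>the variables written with capital X\<close>
  | X_inact sign  \<comment> \<open>the variables written with small x\<close>
  | Y_act sign    \<comment> \<open>the variables written with capital Y\<close>
  | Y_inact sign  \<comment> \<open>the variables written with small y\<close>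
  | D_var         \<comment> \<open>the variable d\<close>

definition proper_labeling ::
  "('v, 'e) multigraph \<Rightarrow> 'e set \<Rightarrow> ('e \<Rightarrow> nat) \<Rightarrow> bool" where
  "proper_labeling G H \<phi> \<longleftrightarrow>
     (\<forall>e\<in>H. \<phi> e = 0) \<and> inj_on \<phi> (edges G - H) \<and> (\<forall>e\<in>edges G - H. 0 < \<phi> e)"

definition contracting_sets :: "('v, 'e) multigraph \<Rightarrow> 'e set \<Rightarrow> 'e set set" where
  "contracting_sets G H = {C. C \<subseteq> edges G - H \<and>
     (\<nexists>F. is_cycle G F \<and> F \<subseteq> C) \<and>
     (\<nexists>F. is_cocycle G F \<and> F \<subseteq> edges G - (C \<union> H))}"

definition internally_active ::
  "('v, 'e) multigraph \<Rightarrow> 'e set \<Rightarrow> ('e \<Rightarrow> nat) \<Rightarrow> 'e set \<Rightarrow> 'e \<Rightarrow> bool" where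
  "internally_active G H \<phi> C e \<longleftrightarrow> e \<in> C \<and>
     (\<exists>F. is_cocycle G F \<and> F \<subseteq> (edges G - (C \<union> H)) \<union> {e} \<and> e \<in> F \<and> (\<forall>f\<in>F. \<phi> e \<le> \<phi> f))"

definition externally_active ::
  "('v, 'e) multigraph \<Rightarrow> 'e set \<Rightarrow> ('e \<Rightarrow> nat) \<Rightarrow> 'e set \<Rightarrow> 'e \<Rightarrow> bool" where
  "externally_active G H \<phi> C f \<longleftrightarrow> f \<in> edges G - (C \<union> H) \<and>
     (\<exists>F. is_cycle G F \<and> F \<subseteq> C \<union> {f} \<and> f \<in> F \<and> (\<forall>e\<in>F. \<phi> f \<le> \<phi> e))"

definition tutte_weight ::
  "('v, 'e) multigraph \<Rightarrow> 'e set \<Rightarrow> ('e \<Rightarrow> sign) \<Rightarrow> ('e \<Rightarrow> nat) \<Rightarrow> 'e set \<Rightarrow> 'e \<Rightarrow> tutte_var" where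
  "tutte_weight G H color \<phi> C e =
     (if e \<in> C
      then (if internally_active G H \<phi> C e then X_act else X_inact) (color e)
      else (if externally_active G H \<phi> C e then Y_act else Y_inact) (color e))"

text \<open>
  \<open>\<psi>\<close> is indexed by the contracting set \<open>C\<close> rather than by the minor \<open>\<H>\<^sub>C\<close> which \<open>C\<close>
  determines, because the functions \<open>\<psi>\<close> of interest depend on the plane embedding of that minor.
\<close>

definition relative_tutte ::
  "('v, 'e) multigraph \<Rightarrow> 'e set \<Rightarrow> ('e \<Rightarrow> sign) \<Rightarrow> ('e \<Rightarrow> nat) \<Rightarrow>
   ('e set \<Rightarrow> tutte_var mpoly) \<Rightarrow> tutte_var mpoly" where
  "relative_tutte G H color \<phi> \<psi> =
     (\<Sum>C\<in>contracting_sets G H.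
        (\<Prod>e\<in>edges G - H. mvar (tutte_weight G H color \<phi> C e)) * \<psi> C)"


section \<open>Virtual link diagrams\<close>

text \<open>
  A diagram is given, up to isotopy of the plane, by its combinatorial map. A dart is a half-edge
  of the plane graph formed by the curves; \<open>arc\<close> sends a dart to the other half of its edge, and
  \<open>rot\<close> sends it to the next dart counterclockwise around its vertex. Crossings are the vertices
  of valence four. Vertices of valence two are base points subdividing a curve; they give darts to
  curves without crossings and have no other effect.

  The corner of a dart \<open>x\<close> is the angular sector from \<open>x\<close> counterclockwise to \<open>rot x\<close>, and
  \<open>region x\<close> is the complementary region containing that corner, which is also the region to the
  left of \<open>x\<close> when leaving the vertex. The field \<open>outer\<close> is the unbounded region, \<open>virt\<close> the set of
  virtual crossings, and \<open>over\<close> contains the darts of the over-strands at classical crossings.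
\<close>

record ('d, 'r) diagram =
  darts :: "'d set"
  arc :: "'d \<Rightarrow> 'd"
  rot :: "'d \<Rightarrow> 'd"
  region :: "'d \<Rightarrow> 'r"
  outer :: 'r
  virt :: "'d set set"
  over :: "'d set"

definition arcs :: "('d, 'r) diagram \<Rightarrow> 'd set set" where
  "arcs K = orbit (arc K) ` darts K"

definition vertices :: "('d, 'r) diagram \<Rightarrow> 'd set set" where
  "vertices K = orbit (rot K) ` darts K"

definition crossings :: "('d, 'r) diagram \<Rightarrow> 'd set set" where
  "crossings K = {v \<in> vertices K. card v = 4}"

definition base_points :: "('d, 'r) diagram \<Rightarrow> 'd set set" where
  "base_points K = {v \<in> vertices K. card v = 2}"

definition classical :: "('d, 'r) diagram \<Rightarrow> 'd set set" where
  "classical K = crossings K - virt K"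

text \<open>The next corner met when following, along its left side, the arc of a dart.\<close>

definition face_step :: "('d, 'r) diagram \<Rightarrow> 'd \<Rightarrow> 'd" where
  "face_step K = inv (rot K) \<circ> arc K"

definition faces :: "('d, 'r) diagram \<Rightarrow> 'd set set" where
  "faces K = orbit (face_step K) ` darts K"

definition regions :: "('d, 'r) diagram \<Rightarrow> 'r set" where
  "regions K = region K ` darts K"

text \<open>Connected components of the plane graph, as sets of darts.\<close>

definition pieces :: "('d, 'r) diagram \<Rightarrow> 'd set set" where
  "pieces K = connected_classes (darts K)
     ((\<lambda>x. (x, arc K x)) ` darts K \<union> (\<lambda>x. (x, rot K x)) ` darts K)"

definition genus_zero :: "('d, 'r) diagram \<Rightarrow> 'd set \<Rightarrow> bool" where
  "genus_zero K Q \<longleftrightarrow>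
     card {v \<in> vertices K. v \<subseteq> Q} + card {f \<in> faces K. f \<subseteq> Q} = card {a \<in> arcs K. a \<subseteq> Q} + 2"

text \<open>
  A face of a connected piece of the diagram is an open disc, which may contain further pieces; the
  region along its boundary is what these leave of it. Joining, for each face, its piece and its
  region gives a graph which is a tree exactly when the pieces, each drawn on a sphere, are placed
  inside faces of one another so as to form a diagram on a single sphere.
\<close>

definition nesting_graph :: "('d, 'r) diagram \<Rightarrow> ('d set + 'r, 'd set) multigraph" where
  "nesting_graph K = \<lparr>
     verts = Inl ` pieces K \<union> Inr ` regions K,
     edges = faces K,
     ends = (\<lambda>f. Inl ` {Q \<in> pieces K. f \<subseteq> Q} \<union> Inr ` region K ` f) \<rparr>"

definition virtual_link_diagram :: "('d, 'r) diagram \<Rightarrow> bool" where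
  "virtual_link_diagram K \<longleftrightarrow>
     finite (darts K) \<and> darts K \<noteq> {} \<and>
     arc K permutes darts K \<and> (\<forall>x\<in>darts K. arc K x \<noteq> x \<and> arc K (arc K x) = x) \<and>
     rot K permutes darts K \<and> (\<forall>v\<in>vertices K. card v = 2 \<or> card v = 4) \<and>
     (\<forall>x\<in>darts K. region K (face_step K x) = region K x) \<and>
     (\<forall>Q\<in>pieces K. genus_zero K Q) \<and>
     is_tree (nesting_graph K) \<and>
     outer K \<in> regions K \<and>
     virt K \<subseteq> crossings K \<and>
     over K \<subseteq> \<Union>(classical K) \<and>
     (\<forall>x\<in>\<Union>(classical K). x \<in> over K \<longleftrightarrow> rot K x \<notin> over K)"


section \<open>Smoothings and the Kauffman bracket\<close>

text \<open>
  The closed curves left when, at every classical crossing, the two opposite corners belonging to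
  \<open>M\<close> are merged: the darts bounding each of the other two corners become joined. At a virtual
  crossing the curves run straight through.
\<close>

definition curves :: "('d, 'r) diagram \<Rightarrow> 'd set \<Rightarrow> 'd set set" where
  "curves K M = connected_classes (darts K)
     ((\<lambda>x. (x, arc K x)) ` darts K \<union>
      (\<lambda>x. (x, rot K x)) ` \<Union>(base_points K) \<union>
      (\<lambda>x. (x, rot K (rot K x))) ` \<Union>(virt K) \<union>
      (\<lambda>x. (x, rot K x)) ` (\<Union>(classical K) - M))"

text \<open>
  Rotating the over-strand counterclockwise sweeps the corners of the over-darts, so these are the
  A-corners. A state is given by the set \<open>s\<close> of crossings that receive the A-smoothing.
\<close>

definition A_corners :: "('d, 'r) diagram \<Rightarrow> 'd set \<Rightarrow> 'd set" where
  "A_corners K c = {x \<in> c. x \<in> over K}"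

definition B_corners :: "('d, 'r) diagram \<Rightarrow> 'd set \<Rightarrow> 'd set" where
  "B_corners K c = {x \<in> c. x \<notin> over K}"

definition state_curves :: "('d, 'r) diagram \<Rightarrow> 'd set set \<Rightarrow> 'd set set" where
  "state_curves K s =
     curves K (\<Union>(A_corners K ` s) \<union> \<Union>(B_corners K ` (classical K - s)))"

definition kauffman_d :: laurent where
  "kauffman_d = - A_pow 2 - A_pow (- 2)"

definition kauffman_bracket :: "('d, 'r) diagram \<Rightarrow> laurent" where
  "kauffman_bracket K = (\<Sum>s\<in>Pow (classical K).
     A_pow (int (card s) - int (card (classical K - s))) *
     kauffman_d ^ (card (state_curves K s) - 1))"


section \<open>The face graph\<close>

definition checkerboard_shading :: "('d, 'r) diagram \<Rightarrow> 'r set \<Rightarrow> bool" where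
  "checkerboard_shading K S \<longleftrightarrow>
     S \<subseteq> regions K \<and> outer K \<notin> S \<and>
     (\<forall>x\<in>darts K. region K x \<in> S \<longleftrightarrow> region K (rot K x) \<notin> S)"

definition dark_corners :: "('d, 'r) diagram \<Rightarrow> 'r set \<Rightarrow> 'd set \<Rightarrow> 'd set" where
  "dark_corners K S c = {x \<in> c. region K x \<in> S}"

definition white_corners :: "('d, 'r) diagram \<Rightarrow> 'r set \<Rightarrow> 'd set \<Rightarrow> 'd set" where
  "white_corners K S c = {x \<in> c. region K x \<notin> S}"

definition face_graph :: "('d, 'r) diagram \<Rightarrow> 'r set \<Rightarrow> ('r, 'd set) multigraph" where
  "face_graph K S = \<lparr>
     verts = S,
     edges = crossings K,
     ends = (\<lambda>c. region K ` dark_corners K S c) \<rparr>"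

definition edge_color :: "('d, 'r) diagram \<Rightarrow> 'r set \<Rightarrow> 'd set \<Rightarrow> sign" where
  "edge_color K S c = (if dark_corners K S c = A_corners K c then Plus else Minus)"

text \<open>
  The zero order of \<open>\<H>\<^sub>C\<close>: the number of components of the diagram obtained by merging the dark
  regions at the crossings in \<open>C\<close> and the white regions at the other classical crossings.
\<close>

definition zero_order :: "('d, 'r) diagram \<Rightarrow> 'r set \<Rightarrow> 'd set set \<Rightarrow> nat" where
  "zero_order K S C = card (curves K
     (\<Union>(dark_corners K S ` C) \<union> \<Union>(white_corners K S ` (classical K - C))))"

definition diagram_tutte ::
  "('d, 'r) diagram \<Rightarrow> 'r set \<Rightarrow> ('d set \<Rightarrow> nat) \<Rightarrow> tutte_var mpoly" where
  "diagram_tutte K S \<phi> =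
     relative_tutte (face_graph K S) (virt K) (edge_color K S) \<phi>
       (\<lambda>C. mvar D_var ^ (zero_order K S C - 1))"

fun kauffman_substitution :: "tutte_var \<Rightarrow> laurent" where
  "kauffman_substitution (X_act Plus) = - A_pow (- 3)"
| "kauffman_substitution (X_act Minus) = - A_pow 3"
| "kauffman_substitution (Y_act Plus) = - A_pow 3"
| "kauffman_substitution (Y_act Minus) = - A_pow (- 3)"
| "kauffman_substitution (X_inact Plus) = A_pow 1"
| "kauffman_substitution (X_inact Minus) = A_pow (- 1)"
| "kauffman_substitution (Y_inact Plus) = A_pow (- 1)"
| "kauffman_substitution (Y_inact Minus) = A_pow 1"
| "kauffman_substitution D_var = - (A_pow 2 + A_pow (- 2))"

end

theory Submission
  imports Defs
begin

text \<open>
  Write the bracket as a sum over all sets \<open>B\<close> of classical crossings, those at which the dark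
  regions are merged. Processing the crossings by decreasing label, the activity of an edge depends
  only on the choices already made. If \<open>e\<close> closes a cycle with edges of \<open>B\<close>, this cycle is a Jordan
  curve through dark regions that separates the two strands at \<open>e\<close>, so merging the dark regions at
  \<open>e\<close> produces one more curve; dually, if \<open>e\<close> and edges outside \<open>B\<close> form a cocycle, merging the
  white regions produces one more curve. This is where \<open>Y = x * d + y\<close> and \<open>X = x + y * d\<close> arise.
  Virtual crossings do no harm, since the Jordan curves never pass through them.
\<close>

section \<open>Substitution into polynomials\<close>

text \<open>Diagrams are purely combinatorial here, so the Jordan curve theorem takes an algebraic
  form. A system of closed curves is recorded by the set \<open>X\<close> of corners through which
  it passes; if \<open>X\<close> meets every vertex and every face in an even number of corners,
  then Euler's formula and rank-nullity over the field with two elements give a set \<open>P\<close>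
  of darts whose membership switches around a vertex exactly at \<open>X\<close>. The obstacle is a
  disconnected diagram. A dark region may then be bounded by several faces, and a cycle of the face
  graph may enter it through one and leave through another, so evenness on a single face is not a
  local fact; it comes from the nesting graph being a tree. On the white side a walk around one face
  is enough, because a cut is given by a labeling of the dark regions. For this reason a cocycle is
  replaced by a cut contained in it. On the Tutte side an active edge leaves contracting sets in
  only one of its two branches. In the bracket the other branch is present and equals
  \<open>d\<close> times the first.\<close>

lemma prod_keys_superset:
  fixes \<rho> :: "'v \<Rightarrow> 'a::comm_ring_1" and m :: "'v \<Rightarrow>\<^sub>0 nat"
  assumes "finite B" "Poly_Mapping.keys m \<subseteq> B"
  shows "(\<Prod>v\<in>Poly_Mapping.keys m. \<rho> v ^ Poly_Mapping.lookup m v)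
       = (\<Prod>v\<in>B. \<rho> v ^ Poly_Mapping.lookup m v)"
  using assms by (intro prod.mono_neutral_left) (auto simp: in_keys_iff)

text \<open>Cancellation can make the keys of a sum smaller than the union of the keys; a common
  index set lets additivity be checked term by term.\<close>

lemma substitute_superset:
  assumes "finite B" "Poly_Mapping.keys p \<subseteq> B"
  shows "substitute \<rho> p = (\<Sum>m\<in>B. of_int (Poly_Mapping.lookup p m) *
     (\<Prod>v\<in>Poly_Mapping.keys m. \<rho> v ^ Poly_Mapping.lookup m v))"
  unfolding substitute_def using assms
  by (intro sum.mono_neutral_left) (auto simp: in_keys_iff)

lemma substitute_single:
  "substitute \<rho> (Poly_Mapping.single m c) =
     of_int c * (\<Prod>v\<in>Poly_Mapping.keys m. \<rho> v ^ Poly_Mapping.lookup m v)"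
  by (subst substitute_superset[of "{m}"]) auto

lemma substitute_add: "substitute \<rho> (p + q) = substitute \<rho> p + substitute \<rho> q"
proof -
  let ?B = "Poly_Mapping.keys p \<union> Poly_Mapping.keys q"
  have "Poly_Mapping.keys (p + q) \<subseteq> ?B"
    by (rule keys_add)
  then show ?thesis
    by (simp add: substitute_superset[of ?B] lookup_add distrib_right sum.distrib)
qed

text \<open>Updating at a fresh key is the same as adding a monomial. In this form the induction
  reduces a bilinear identity such as multiplicativity of \<open>substitute\<close> to
  monomials.\<close>

lemma single_add_induct [case_names single add]:
  fixes p :: "'k \<Rightarrow>\<^sub>0 'c::comm_monoid_add"
  assumes single: "\<And>m c. P (Poly_Mapping.single m c)" and add: "\<And>p q. P p \<Longrightarrow> P q \<Longrightarrow> P (p + q)"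
  shows "P p"
proof (induction p rule: Poly_Mapping.update_induct)
  case const
  then show ?case using single[of undefined 0] by simp
next
  case (update f a b)
  have "Poly_Mapping.update a b f = f + Poly_Mapping.single a b"
    using update.hyps
    by (intro poly_mapping_eqI) (auto simp: lookup_update lookup_add lookup_single in_keys_iff when_def)
  then show ?case using add[OF update.IH single] by simp
qed

lemma substitute_mult: "substitute \<rho> (p * q) = substitute \<rho> p * substitute \<rho> q"
proof (induction p rule: single_add_induct)
  case (single m c)
  show ?case
  proof (induction q rule: single_add_induct)
    case (single n e)
    let ?B = "Poly_Mapping.keys m \<union> Poly_Mapping.keys n"
    have "Poly_Mapping.keys (m + n) \<subseteq> ?B"
      by (rule keys_add)
    then show ?case
      unfolding mult_single substitute_single
      by (subst (1 2 3) prod_keys_superset[of ?B]) (simp_all add: lookup_add power_add prod.distrib)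
  next
    case (add p q)
    then show ?case
      by (simp add: distrib_left substitute_add)
  qed
next
  case (add p q)
  then show ?case
    by (simp add: distrib_right substitute_add)
qed

lemma substitute_0: "substitute \<rho> 0 = 0"
  by (simp add: substitute_def)

lemma substitute_1: "substitute \<rho> 1 = 1"
  by (simp add: substitute_single flip: single_one)

lemma substitute_mvar: "substitute \<rho> (mvar v) = \<rho> v"
  by (simp add: mvar_def substitute_single)

lemma substitute_sum: "substitute \<rho> (sum f B) = (\<Sum>x\<in>B. substitute \<rho> (f x))"
  by (induction B rule: infinite_finite_induct) (simp_all add: substitute_0 substitute_add)

lemma substitute_prod: "substitute \<rho> (prod f B) = (\<Prod>x\<in>B. substitute \<rho> (f x))"
  by (induction B rule: infinite_finite_induct) (simp_all add: substitute_1 substitute_mult)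

lemma substitute_power: "substitute \<rho> (p ^ n) = substitute \<rho> p ^ n"
  by (induction n) (simp_all add: substitute_1 substitute_mult)

section \<open>Parity\<close>

text \<open>As \<open>T\<close> permutes \<open>B\<close>, the elements with \<open>u x\<close> and
  those with \<open>u (T x)\<close> are equally many, so changes from true to false balance those
  from false to true. It is applied to closed walks: around a cycle, a vertex or a face.\<close>

lemma even_card_changes:
  fixes u :: "'a \<Rightarrow> bool"
  assumes "finite B" "bij_betw T B B"
  shows "even (card {x \<in> B. u x \<noteq> u (T x)})"
proof -
  have img: "bij_betw T {x \<in> B. u (T x)} {x \<in> B. u x}"
    using assms(2) by (auto simp: bij_betw_def inj_on_def)
  have "card {x \<in> B. u x} = card {x \<in> B. u x \<and> u (T x)} + card {x \<in> B. u x \<and> \<not> u (T x)}"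
    using assms(1) by (subst card_Un_disjoint[symmetric]) (auto intro: arg_cong[where f = card])
  moreover have "card {x \<in> B. u (T x)} =
      card {x \<in> B. u x \<and> u (T x)} + card {x \<in> B. \<not> u x \<and> u (T x)}"
    using assms(1) by (subst card_Un_disjoint[symmetric]) (auto intro: arg_cong[where f = card])
  moreover have "card {x \<in> B. u x \<noteq> u (T x)} =
      card {x \<in> B. u x \<and> \<not> u (T x)} + card {x \<in> B. \<not> u x \<and> u (T x)}"
    using assms(1) by (subst card_Un_disjoint[symmetric]) (auto intro: arg_cong[where f = card])
  ultimately show ?thesis
    using bij_betw_same_card[OF img] by auto
qed

lemma even_card_involution:
  assumes "finite B" "\<And>x. x \<in> B \<Longrightarrow> f x \<in> B \<and> f (f x) = x \<and> f x \<noteq> x"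
  shows "even (card B)"
  using assms
proof (induction "card B" arbitrary: B rule: less_induct)
  case less
  show ?case
  proof (cases "B = {}")
    case False
    then obtain x where x: "x \<in> B" by blast
    let ?B = "B - {x, f x}"
    have "card B = card ?B + 2"
    proof -
      have "B = ?B \<union> {x, f x}" "x \<noteq> f x"
        using less.prems(2)[OF x] x by auto
      then have "card B = card ?B + card {x, f x}"
        using less.prems(1) by (metis Diff_disjoint card_Un_disjoint finite_Un inf_commute)
      then show ?thesis using \<open>x \<noteq> f x\<close> by simp
    qed
    moreover have "even (card ?B)"
    proof (rule less.hyps)
      show "card ?B < card B"
        using \<open>card B = card ?B + 2\<close> by linarith
      show "f y \<in> ?B \<and> f (f y) = y \<and> f y \<noteq> y" if "y \<in> ?B" for y
        using that less.prems(2)[of y] less.prems(2)[OF x] by fastforce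
    qed (use less.prems(1) in simp)
    ultimately show ?thesis by simp
  qed simp
qed

text \<open>Rank-nullity over the field with two elements.\<close>

lemma card_kernel_image:
  fixes s :: "'a set \<Rightarrow> 'b set"
  assumes "finite X" and add: "\<And>A B. A \<subseteq> X \<Longrightarrow> B \<subseteq> X \<Longrightarrow> s (sym_diff A B) = sym_diff (s A) (s B)"
  shows "2 ^ card X = card {A \<in> Pow X. s A = {}} * card (s ` Pow X)"
proof -
  have fibre: "card {A \<in> Pow X. s A = b} = card {A \<in> Pow X. s A = {}}" if "b \<in> s ` Pow X" for b
  proof -
    from that obtain B where B: "B \<subseteq> X" "s B = b" by auto
    have sd: "sym_diff (sym_diff A B) B = A" for A by auto
    have "bij_betw (\<lambda>A. sym_diff A B) {A \<in> Pow X. s A = b} {A \<in> Pow X. s A = {}}"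
      by (rule bij_betw_byWitness[where f' = "\<lambda>A. sym_diff A B"])
        (use B in \<open>auto simp: sd add\<close>)
    then show ?thesis by (rule bij_betw_same_card)
  qed
  have "card (Pow X) = (\<Sum>b\<in>s ` Pow X. card {A \<in> Pow X. s A = b})"
    using sum.image_gen[of "Pow X" "\<lambda>_. 1::nat" s] assms(1) by (simp del: Pow_iff)
  also have "\<dots> = card {A \<in> Pow X. s A = {}} * card (s ` Pow X)"
    by (subst sum.cong[OF refl fibre]) simp_all
  finally show ?thesis
    using assms(1) by (simp add: card_Pow)
qed

section \<open>Connected classes, cycles and cocycles\<close>

lemma equiv_symcl: "equiv UNIV ((R \<union> R\<inverse>)\<^sup>*)"
  by (intro equivI sym_rtrancl trans_rtrancl) (auto simp: refl_on_def sym_def intro: refl_rtrancl)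

lemma connected_classes_eqI:
  assumes "(R \<union> R\<inverse>)\<^sup>* = (R' \<union> R'\<inverse>)\<^sup>*"
  shows "connected_classes V R = connected_classes V R'"
  by (simp add: connected_classes_def assms)

lemma symcl_mono:
  assumes "R \<subseteq> (R' \<union> R'\<inverse>)\<^sup>*"
  shows "(R \<union> R\<inverse>)\<^sup>* \<subseteq> (R' \<union> R'\<inverse>)\<^sup>*"
proof -
  have "R\<inverse> \<subseteq> (R' \<union> R'\<inverse>)\<^sup>*"
    using assms equiv_symcl[of R'] by (auto simp: equiv_def dest: symD)
  then have "(R \<union> R\<inverse>)\<^sup>* \<subseteq> ((R' \<union> R'\<inverse>)\<^sup>*)\<^sup>*"
    using assms by (intro rtrancl_mono) auto
  then show ?thesis by simp
qed

lemma symcl_preserves: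
  assumes "(x, y) \<in> (R \<union> R\<inverse>)\<^sup>*" "\<And>a b. (a, b) \<in> R \<Longrightarrow> h a = h b"
  shows "h x = h y"
  using assms(1) by (induction rule: rtrancl_induct) (use assms(2) in fastforce)+

lemma card_connected_classes_insert:
  assumes "finite V" "x \<in> V" "y \<in> V" "(x, y) \<notin> (R \<union> R\<inverse>)\<^sup>*"
  shows "card (connected_classes V R) = card (connected_classes V (insert (x, y) R)) + 1"
proof -
  define r where "r = (R \<union> R\<inverse>)\<^sup>*"
  define r' where "r' = (insert (x, y) R \<union> (insert (x, y) R)\<inverse>)\<^sup>*"
  have eq: "equiv UNIV r"
    unfolding r_def by (rule equiv_symcl)
  have eq': "equiv UNIV r'"
    unfolding r'_def by (rule equiv_symcl)
  have sub: "r \<subseteq> r'"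
    unfolding r_def r'_def by (rule rtrancl_mono) auto
  \<comment> \<open>\<open>?t\<close> retracts the class of \<open>y\<close> to the point
    \<open>x\<close> and fixes everything else; the enlarged relation is the pullback of the old one
    along it.\<close>
  let ?t = "\<lambda>z. if (z, y) \<in> r then x else z"
  have iff: "(a, b) \<in> r' \<longleftrightarrow> (?t a, ?t b) \<in> r" for a b
  proof
    assume "(a, b) \<in> r'"
    then have "r `` {?t a} = r `` {?t b}"
      unfolding r'_def
    proof (rule symcl_preserves[where h = "\<lambda>z. r `` {?t z}"])
      fix a b assume "(a, b) \<in> insert (x, y) R"
      then consider "a = x" "b = y" | "(a, b) \<in> r"
        unfolding r_def by auto
      then show "r `` {?t a} = r `` {?t b}"
      proof cases
        case 2
        then have "(a, y) \<in> r \<longleftrightarrow> (b, y) \<in> r"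
          using eq by (meson equivE symE transE)
        then show ?thesis using 2 eq by (auto simp: equiv_class_eq_iff)
      qed (use eq assms(4) in \<open>auto simp: r_def[symmetric] equiv_def refl_on_def\<close>)
    qed
    then show "(?t a, ?t b) \<in> r"
      using eq by (simp add: equiv_class_eq_iff)
  next
    have xy: "(x, y) \<in> r'"
      unfolding r'_def by auto
    have t: "(z, ?t z) \<in> r'" for z
      using eq' xy sub by (auto simp: equiv_def refl_on_def dest: symD transD)
    assume "(?t a, ?t b) \<in> r"
    then show "(a, b) \<in> r'"
      using t[of a] t[of b] sub eq' by (meson equivE subsetD symE transE)
  qed
  \<comment> \<open>Each new class is the saturation of exactly one old class other than that of
    \<open>y\<close>, which is absorbed by the class of \<open>x\<close>.\<close>
  have bij: "bij_betw (\<lambda>c. r' `` c) (V // r - {r `` {y}}) (V // r')"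
  proof (rule bij_betw_imageI)
    have cl: "r' `` (r `` {z}) = r' `` {z}" for z
      using sub eq eq' by (auto simp: equiv_def refl_on_def dest: transD)
    show "inj_on (\<lambda>c. r' `` c) (V // r - {r `` {y}})"
    proof (rule inj_onI)
      fix c d assume c: "c \<in> V // r - {r `` {y}}" and d: "d \<in> V // r - {r `` {y}}"
        and "r' `` c = r' `` d"
      from c d obtain a b where ab: "c = r `` {a}" "d = r `` {b}"
        by (auto simp: quotient_def)
      have "(a, y) \<notin> r" "(b, y) \<notin> r"
        using c d ab eq by (auto simp: equiv_class_eq_iff)
      moreover have "(a, b) \<in> r'"
        using \<open>r' `` c = r' `` d\<close> eq' by (simp add: ab cl equiv_class_eq_iff)
      ultimately show "c = d"
        using eq iff by (simp add: ab equiv_class_eq_iff)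
    qed
    show "(\<lambda>c. r' `` c) ` (V // r - {r `` {y}}) = V // r'"
    proof (intro equalityI subsetI)
      fix d assume "d \<in> V // r'"
      then obtain a where a: "a \<in> V" "d = r' `` {a}" by (auto simp: quotient_def)
      have "(x, y) \<notin> r" using assms(4) by (simp add: r_def)
      then have "r `` {?t a} \<noteq> r `` {y}" "?t a \<in> V"
        using eq a assms(2) by (auto simp: equiv_class_eq_iff)
      moreover have "(a, ?t a) \<in> r'"
        using iff[of a "?t a"] \<open>(x, y) \<notin> r\<close> eq by (auto simp: equiv_def refl_on_def)
      then have "d = r' `` (r `` {?t a})"
        using eq' a(2) unfolding cl by (simp add: equiv_class_eq_iff)
      moreover have "r `` {?t a} \<in> V // r"
        using calculation(2) by (rule quotientI)
      ultimately show "d \<in> (\<lambda>c. r' `` c) ` (V // r - {r `` {y}})"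
        by blast
    qed (auto simp: quotient_def cl)
  qed
  have "finite (V // r)"
    using assms(1) by (simp add: quotient_def)
  moreover have "r `` {y} \<in> V // r"
    using assms(3) by (auto simp: quotient_def)
  ultimately have "card (V // r) = card (V // r - {r `` {y}}) + 1"
    by (metis Suc_eq_plus1 card.remove)
  then show ?thesis
    using bij_betw_same_card[OF bij] by (simp add: connected_classes_def r_def r'_def)
qed

section \<open>Cuts, their parity pairing with cycles, and cuts from cocycles and trees\<close>

definition cut :: "('v, 'e) multigraph \<Rightarrow> ('v \<Rightarrow> bool) \<Rightarrow> 'e set" where
  "cut G h = {e \<in> edges G. \<exists>u\<in>verts G. \<exists>v\<in>verts G. ends G e = {u, v} \<and> h u \<noteq> h v}"

text \<open>A labeling of the vertices changes an even number of times along a closed walk. Loops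
  are covered: there the cyclic successor of position 0 is 0 and nothing changes.\<close>

lemma even_card_cycle_inter_cut:
  assumes "is_cycle G F"
  shows "even (card (F \<inter> cut G h))"
proof -
  from assms obtain vs es where *: "es \<noteq> []" "length vs = length es" "distinct es"
    "set vs \<subseteq> verts G" "set es \<subseteq> edges G" "F = set es"
    "\<And>i. i < length es \<Longrightarrow> ends G (es ! i) = {vs ! i, vs ! (Suc i mod length es)}"
    unfolding is_cycle_def by blast
  let ?n = "length es"
  let ?T = "\<lambda>i. Suc i mod ?n"
  have n: "?n > 0" using *(1) by simp
  have mem: "es ! i \<in> cut G h \<longleftrightarrow> h (vs ! i) \<noteq> h (vs ! ?T i)" if "i < ?n" for i
  proof -
    have "vs ! i \<in> verts G" "vs ! ?T i \<in> verts G" "es ! i \<in> edges G"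
      using * that n by (auto simp: subset_iff)
    then show ?thesis
      using *(7)[OF that] by (fastforce simp: cut_def doubleton_eq_iff)
  qed
  have "bij_betw ?T {..<?n} {..<?n}"
  proof (rule bij_betw_imageI)
    show inj: "inj_on ?T {..<?n}"
      by (rule inj_onI) (auto simp: mod_Suc split: if_splits)
    show "?T ` {..<?n} = {..<?n}"
      using n by (intro card_subset_eq) (auto simp: card_image[OF inj])
  qed
  then have "even (card {i \<in> {..<?n}. h (vs ! i) \<noteq> h (vs ! ?T i)})"
    by (intro even_card_changes[where u = "\<lambda>i. h (vs ! i)"]) auto
  moreover have "bij_betw ((!) es) {i \<in> {..<?n}. h (vs ! i) \<noteq> h (vs ! ?T i)} (F \<inter> cut G h)"
    using *(3) mem by (auto simp: bij_betw_def inj_on_def nth_eq_iff_index_eq *(6) in_set_conv_nth)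
  ultimately show ?thesis
    by (simp add: bij_betw_same_card)
qed

definition incidence :: "('v, 'e) multigraph \<Rightarrow> 'e set \<Rightarrow> ('v \<times> 'v) set" where
  "incidence G F = {(u, v). u \<in> verts G \<and> v \<in> verts G \<and> (\<exists>e\<in>F. ends G e = {u, v})}"

lemma num_components_incidence: "num_components G F = card (connected_classes (verts G) (incidence G F))"
  by (simp add: num_components_def incidence_def)

text \<open>By minimality, putting \<open>e\<close> back into the graph without \<open>F\<close>
  lowers the number of components, so its ends lie in different components there. The component of
  one end is the labeling \<open>h\<close>; an edge of its cut outside \<open>F\<close> would
  connect this component to another one.\<close>

lemma cocycle_contains_cut:
  assumes "is_cocycle G F" "e \<in> F"
  obtains h where "e \<in> cut G h" "cut G h \<subseteq> F"
proof -
  let ?R = "incidence G (edges G - F)" and ?R' = "incidence G (edges G - (F - {e}))"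
  have F: "F \<subseteq> edges G" "\<not> separating G (F - {e})" "separating G F"
    using assms unfolding is_cocycle_def separating_def by auto
  then have ne: "num_components G (edges G - F) \<noteq> num_components G (edges G - (F - {e}))"
    unfolding separating_def by auto
  have "?R \<subseteq> ?R'" by (auto simp: incidence_def)
  have "\<not> ?R' \<subseteq> (?R \<union> ?R\<inverse>)\<^sup>*"
  proof
    assume "?R' \<subseteq> (?R \<union> ?R\<inverse>)\<^sup>*"
    then have "(?R' \<union> ?R'\<inverse>)\<^sup>* = (?R \<union> ?R\<inverse>)\<^sup>*"
      using \<open>?R \<subseteq> ?R'\<close> by (intro equalityI symcl_mono) auto
    then show False
      using ne unfolding num_components_incidence by (metis connected_classes_eqI)
  qed
  then obtain u v where uv: "(u, v) \<in> ?R'" "(u, v) \<notin> (?R \<union> ?R\<inverse>)\<^sup>*"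
    by auto
  then have ends: "ends G e = {u, v}" "u \<in> verts G" "v \<in> verts G"
    by (auto simp: incidence_def)
  let ?h = "\<lambda>w. (u, w) \<in> (?R \<union> ?R\<inverse>)\<^sup>*"
  show ?thesis
  proof
    show "e \<in> cut G ?h"
      using ends uv F(1) assms(2) by (auto simp: cut_def simp del: insert_iff)
    show "cut G ?h \<subseteq> F"
    proof (rule ccontr)
      assume "\<not> cut G ?h \<subseteq> F"
      then obtain a b where "(a, b) \<in> ?R" "?h a \<noteq> ?h b"
        by (auto simp: cut_def incidence_def)
      then have "(a, b) \<in> (?R \<union> ?R\<inverse>)\<^sup>*" "(b, a) \<in> (?R \<union> ?R\<inverse>)\<^sup>*"
        by auto
      then show False
        using \<open>?h a \<noteq> ?h b\<close> rtrancl_trans by metis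
    qed
  qed
qed

lemma simple_path_exists:
  assumes "(a, b) \<in> (R \<union> R\<inverse>)\<^sup>*"
  obtains vs where "vs \<noteq> []" "hd vs = a" "last vs = b" "distinct vs"
    "\<And>i. Suc i < length vs \<Longrightarrow> (vs ! i, vs ! Suc i) \<in> R \<union> R\<inverse>"
proof -
  from assms have "\<exists>vs. vs \<noteq> [] \<and> hd vs = a \<and> last vs = b \<and> distinct vs \<and>
     (\<forall>i. Suc i < length vs \<longrightarrow> (vs ! i, vs ! Suc i) \<in> R \<union> R\<inverse>)"
  proof (induction rule: converse_rtrancl_induct)
    case base
    show ?case by (rule exI[of _ "[b]"]) simp
  next
    case (step y z)
    then obtain vs where vs: "vs \<noteq> []" "hd vs = z" "last vs = b" "distinct vs"
      "\<And>i. Suc i < length vs \<Longrightarrow> (vs ! i, vs ! Suc i) \<in> R \<union> R\<inverse>" by blast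
    show ?case
    \<comment> \<open>If the new starting point already lies on the path, the detour before it is
      dropped; this keeps the path simple.\<close>
    proof (cases "y \<in> set vs")
      case True
      then obtain k where k: "k < length vs" "vs ! k = y" by (auto simp: in_set_conv_nth)
      show ?thesis
        using vs k by (intro exI[of _ "drop k vs"]) (auto simp: hd_drop_conv_nth)
    next
      case False
      then show ?thesis
        using vs step.hyps by (intro exI[of _ "y # vs"])
          (auto simp: nth_Cons hd_conv_nth split: nat.splits)
    qed
  qed
  then show ?thesis using that by blast
qed

text \<open>\<open>W\<close> is reachability from \<open>a\<close> without \<open>f\<close>. If
  \<open>b\<close> were reachable, a simple path from \<open>a\<close> to \<open>b\<close> closed up
  by \<open>f\<close> would be a cycle.\<close>

lemma acyclic_edge_cut:
  assumes acyclic: "\<nexists>F. is_cycle G F" and f: "f \<in> edges G" and ends: "ends G f = {a, b}"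
    and ab: "a \<in> verts G" "b \<in> verts G"
  obtains W where "W a" "\<not> W b"
    "\<And>e u v. e \<in> edges G \<Longrightarrow> e \<noteq> f \<Longrightarrow> ends G e = {u, v} \<Longrightarrow> u \<in> verts G \<Longrightarrow> v \<in> verts G \<Longrightarrow> W u = W v"
proof -
  let ?R = "incidence G (edges G - {f})"
  let ?W = "\<lambda>w. (a, w) \<in> (?R \<union> ?R\<inverse>)\<^sup>*"
  have Wa: "?W a" by simp
  have const: "?W u = ?W v" if "e \<in> edges G" "e \<noteq> f" "ends G e = {u, v}" "u \<in> verts G" "v \<in> verts G" for e u v
  proof -
    have "(u, v) \<in> ?R" using that by (auto simp: incidence_def)
    then have "(u, v) \<in> (?R \<union> ?R\<inverse>)\<^sup>*" "(v, u) \<in> (?R \<union> ?R\<inverse>)\<^sup>*" by auto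
    then show ?thesis using rtrancl_trans by metis
  qed
  have "\<not> ?W b"
  proof
    assume "?W b"
    then obtain vs where vs: "vs \<noteq> []" "hd vs = a" "last vs = b" "distinct vs"
      "\<And>i. Suc i < length vs \<Longrightarrow> (vs ! i, vs ! Suc i) \<in> ?R \<union> ?R\<inverse>"
      by (rule simple_path_exists) blast
    define m where "m = length vs - 1"
    have m: "length vs = Suc m" using vs(1) by (simp add: m_def)
    have "\<exists>e\<in>edges G - {f}. ends G e = {vs ! i, vs ! Suc i}" if "i < m" for i
      using vs(5)[of i] that m by (auto simp: incidence_def insert_commute)
    then obtain E where E: "\<And>i. i < m \<Longrightarrow> E i \<in> edges G - {f} \<and> ends G (E i) = {vs ! i, vs ! Suc i}"
      by metis
    \<comment> \<open>For \<open>m = 0\<close> the path is a single vertex and \<open>f\<close>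
      alone is the cycle, so the case of a loop needs no separate treatment.\<close>
    let ?es = "map E [0..<m] @ [f]"
    have nth: "?es ! i = (if i < m then E i else f)" if "i < Suc m" for i
      using that by (auto simp: nth_append)
    have inj: "inj_on E {..<m}"
    proof (rule inj_onI)
      fix i j assume ij: "i \<in> {..<m}" "j \<in> {..<m}" "E i = E j"
      then have "{vs ! i, vs ! Suc i} = {vs ! j, vs ! Suc j}"
        using E[of i] E[of j] by auto
      then show "i = j"
        using ij m vs(4) by (auto simp: doubleton_eq_iff nth_eq_iff_index_eq)
    qed
    have ends_path: "vs ! 0 = a" "vs ! m = b"
      using vs(1-3) m by (auto simp: hd_conv_nth last_conv_nth)
    have "is_cycle G (set ?es)"
      unfolding is_cycle_def
    proof (intro exI[of _ vs] exI[of _ ?es] conjI allI impI)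
      show "distinct ?es"
        using inj E by (auto simp: distinct_map atLeast0LessThan)
      show "set vs \<subseteq> verts G"
      proof
        fix w assume "w \<in> set vs"
        then obtain i where i: "i < Suc m" "w = vs ! i" by (auto simp: in_set_conv_nth m)
        show "w \<in> verts G"
        proof (cases "i < m")
          case True
          then show ?thesis using vs(5)[of i] i m by (auto simp: incidence_def)
        next
          case False
          then show ?thesis using i ends_path ab by (metis less_antisym)
        qed
      qed
      show "set ?es \<subseteq> edges G"
        using E f by auto
      fix i assume "i < length ?es"
      then show "ends G (?es ! i) = {vs ! i, vs ! (Suc i mod length ?es)}"
        using E[of i] ends ends_path by (cases "i < m") (auto simp: nth less_Suc_eq mod_Suc)
    qed (use vs m in auto)
    then show False using acyclic by blast
  qed
  with Wa const show ?thesis by (intro that[of ?W])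
qed

section \<open>The activity expansion\<close>

lemma sum_Pow_insert:
  assumes "finite U" "e \<notin> U"
  shows "(\<Sum>B\<in>Pow (insert e U). f B) = (\<Sum>B\<in>Pow U. f B) + (\<Sum>B\<in>Pow U. f (insert e B))"
proof -
  have "inj_on (insert e) (Pow U)"
    using assms(2) by (auto simp: inj_on_def)
  moreover have "Pow U \<inter> insert e ` Pow U = {}"
    using assms(2) by auto
  ultimately show ?thesis
    using assms(1) by (simp add: Pow_insert sum.union_disjoint sum.reindex)
qed

text \<open>This isolates the combinatorics of activities from diagrams. All topology enters through
  \<open>loop\<close> and \<open>bridge\<close>, which say how \<open>k\<close>, later the zero
  order, reacts to moving one edge. \<open>X_eq\<close> and \<open>Y_eq\<close> say that an active
  weight is the sum of both inactive weights, with \<open>d\<close> attached to the branch that has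
  one more component.\<close>

locale activity_expansion =
  fixes G :: "('v, 'e) multigraph" and H :: "'e set" and \<phi> :: "'e \<Rightarrow> nat"
    and X x Y y :: "'e \<Rightarrow> 'a::comm_ring_1" and d :: 'a and k :: "'e set \<Rightarrow> nat"
  assumes finite_regular: "finite (edges G - H)"
    and inj_label: "inj_on \<phi> (edges G - H)"
    and k_pos: "\<And>B. B \<subseteq> edges G - H \<Longrightarrow> 0 < k B"
    and loop: "\<And>B e F. B \<subseteq> edges G - H \<Longrightarrow> e \<in> edges G - H \<Longrightarrow> e \<notin> B \<Longrightarrow>
      is_cycle G F \<Longrightarrow> F \<subseteq> insert e B \<Longrightarrow> e \<in> F \<Longrightarrow> k (insert e B) = k B + 1"
    and bridge: "\<And>B e F. B \<subseteq> edges G - H \<Longrightarrow> e \<in> edges G - H \<Longrightarrow> e \<notin> B \<Longrightarrow>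
      is_cocycle G F \<Longrightarrow> F \<subseteq> edges G - H - B \<Longrightarrow> e \<in> F \<Longrightarrow> k B = k (insert e B) + 1"
    and X_eq: "\<And>e. e \<in> edges G - H \<Longrightarrow> X e = x e + y e * d"
    and Y_eq: "\<And>e. e \<in> edges G - H \<Longrightarrow> Y e = x e * d + y e"
begin

abbreviation "regular \<equiv> edges G - H"

definition weight :: "'e set \<Rightarrow> 'e \<Rightarrow> 'a" where
  "weight C e = (if e \<in> C then (if internally_active G H \<phi> C e then X e else x e)
     else (if externally_active G H \<phi> C e then Y e else y e))"

text \<open>
  Both sums range over the sets that agree with \<open>C\<close> on the edges already processed, namely those
  outside \<open>U\<close>; only the factors of the edges in \<open>U\<close> are taken.
\<close>

definition tutte_sum :: "'e set \<Rightarrow> 'e set \<Rightarrow> 'a" where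
  "tutte_sum U C = (\<Sum>B\<in>Pow U. if C \<union> B \<in> contracting_sets G H
     then (\<Prod>e\<in>U. weight (C \<union> B) e) * d ^ (k (C \<union> B) - 1) else 0)"

definition state_sum :: "'e set \<Rightarrow> 'e set \<Rightarrow> 'a" where
  "state_sum U C = (\<Sum>B\<in>Pow U. (\<Prod>e\<in>U. if e \<in> B then x e else y e) * d ^ (k (C \<union> B) - 1))"

lemma state_sum_insert:
  assumes "finite U" "e \<notin> U"
  shows "state_sum (insert e U) C = y e * state_sum U C + x e * state_sum U (insert e C)"
proof -
  have "(\<Prod>a\<in>U. if a = e \<or> a \<in> B then x a else y a) = (\<Prod>a\<in>U. if a \<in> B then x a else y a)" for B
    using assms(2) by (intro prod.cong) auto
  moreover have "e \<notin> B" if "B \<in> Pow U" for B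
    using that assms(2) by auto
  ultimately show ?thesis
    using assms unfolding state_sum_def
    by (simp add: sum_Pow_insert sum_distrib_left mult.assoc cong: sum.cong_simp)
qed

text \<open>The weight of \<open>e\<close> could depend on the whole contracting set; the recursion
  requires it to be constant over all completions \<open>B\<close> of the choices made.\<close>

lemma tutte_sum_insert:
  assumes "finite U" "e \<notin> U" "e \<notin> C"
    and "\<And>B. B \<subseteq> U \<Longrightarrow> C \<union> B \<in> contracting_sets G H \<Longrightarrow> weight (C \<union> B) e = w"
    and "\<And>B. B \<subseteq> U \<Longrightarrow> insert e C \<union> B \<in> contracting_sets G H \<Longrightarrow> weight (insert e C \<union> B) e = w'"
  shows "tutte_sum (insert e U) C = w * tutte_sum U C + w' * tutte_sum U (insert e C)"
  using assms unfolding tutte_sum_def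
  by (simp add: sum_Pow_insert sum_distrib_left mult.assoc if_distrib cong: sum.cong_simp if_cong)

text \<open>The cut through \<open>e\<close> inside the cocycle would meet the cycle in
  \<open>e\<close> alone, an odd number of edges.\<close>

lemma cycle_cocycle_not_single:
  assumes "is_cycle G F" "is_cocycle G F'" "F \<inter> F' = {e}"
  shows False
proof -
  obtain h where h: "e \<in> cut G h" "cut G h \<subseteq> F'"
    using cocycle_contains_cut[OF assms(2)] assms(3) by (metis IntD2 insertI1)
  then have "F \<inter> cut G h = {e}"
    using assms(3) by blast
  then show False
    using even_card_cycle_inter_cut[OF assms(1), of h] by simp
qed

text \<open>Induction on the number of unprocessed edges. The invariants are that the chosen edges
  \<open>C\<close> contain no cycle, the rejected ones contain no cocycle, and every processed label
  exceeds every label in \<open>U\<close>. The next edge closes a cycle with \<open>C\<close>, or a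
  cocycle with the rejected edges, or neither, but never both. In either of the first two cases one
  Tutte branch vanishes, and the corresponding branch of the state sum is \<open>d\<close> times the
  surviving one.\<close>

lemma tutte_sum_eq_state_sum:
  assumes "U \<subseteq> regular" "C \<subseteq> regular - U"
    and "\<And>u v. u \<in> U \<Longrightarrow> v \<in> regular - U \<Longrightarrow> \<phi> u < \<phi> v"
    and "\<nexists>F. is_cycle G F \<and> F \<subseteq> C" "\<nexists>F. is_cocycle G F \<and> F \<subseteq> regular - U - C"
  shows "tutte_sum U C = state_sum U C"
  using assms
proof (induction "card U" arbitrary: U C)
  case 0
  then have "U = {}"
    using finite_subset[OF _ finite_regular] by auto
  \<comment> \<open>With no edge left to process, the two invariants are exactly the conditions
    defining a contracting set.\<close>
  moreover from this have "C \<in> contracting_sets G H"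
    using 0 unfolding contracting_sets_def by (auto simp: Diff_Diff_Int Diff_eq Int_ac)
  ultimately show ?case
    by (simp add: tutte_sum_def state_sum_def)
next
  case (Suc n)
  have finU: "finite U"
    using Suc.prems(1) finite_regular finite_subset by blast
  have "U \<noteq> {}" using Suc.hyps(2) by auto
  \<comment> \<open>Taking the largest remaining label makes \<open>e\<close> smaller than all
    processed edges and larger than all that are still open.\<close>
  then obtain e where e: "e \<in> U" "\<phi> e = Max (\<phi> ` U)"
    using finU by (metis (no_types, opaque_lifting) Max_in finite_imageI imageE image_is_empty)
  define U' where "U' = U - {e}"
  have U: "U = insert e U'" and eU': "e \<notin> U'" and finU': "finite U'" and cardU': "card U' = n"
    using e finU Suc.hyps(2) by (auto simp: U'_def)
  have e_reg: "e \<in> regular" and eC: "e \<notin> C"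
    using Suc.prems(1,2) e(1) by auto
  have lt: "\<phi> u < \<phi> e" if "u \<in> U'" for u
  proof -
    have "\<phi> u \<le> \<phi> e" "u \<in> regular" "u \<noteq> e"
      using that finU e Suc.prems(1) by (auto simp: U'_def)
    moreover from this have "\<phi> u \<noteq> \<phi> e"
      using inj_label e_reg by (auto dest: inj_onD)
    ultimately show ?thesis by simp
  qed
  have gt: "\<phi> e < \<phi> v" if "v \<in> regular - U" for v
    using Suc.prems(3)[OF e(1) that] .
  let ?D = "regular - U - C"
  have D': "regular - U' - C = insert e ?D" and D'': "regular - U' - insert e C = ?D"
    using e_reg eC U eU' by auto
  let ?L = "\<exists>F. is_cycle G F \<and> F \<subseteq> insert e C"
  let ?B = "\<exists>F. is_cocycle G F \<and> F \<subseteq> insert e ?D"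
  have not_both: "\<not> (?L \<and> ?B)"
  proof
    assume "?L \<and> ?B"
    then obtain F F' where F: "is_cycle G F" "F \<subseteq> insert e C" "is_cocycle G F'" "F' \<subseteq> insert e ?D"
      by blast
    then have "e \<in> F" "e \<in> F'"
      using Suc.prems(4,5) by blast+
    then have "F \<inter> F' = {e}"
      using F by blast
    with F show False
      by (intro cycle_cocycle_not_single)
  qed
  have order': "\<phi> u < \<phi> v" if "u \<in> U'" "v \<in> regular - U'" for u v
    using that lt[of u] gt[of v] U by (cases "v = e") auto
  have IH1: "tutte_sum U' C = state_sum U' C" if "\<not> ?B"
    using that Suc.prems(1,2,4) order' U cardU' by (intro Suc.hyps(1)) (auto simp: D')
  have IH2: "tutte_sum U' (insert e C) = state_sum U' (insert e C)" if "\<not> ?L"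
    using that Suc.prems(1,2,5) order' U eU' cardU' e_reg
    by (intro Suc.hyps(1)) (auto simp: D'')
  \<comment> \<open>Edges of \<open>B\<close> have smaller labels than \<open>e\<close>, so a cycle
    in which \<open>e\<close> is smallest avoids them; edges of \<open>C\<close> have larger labels,
    so in a cycle that \<open>e\<close> closes with \<open>C\<close> it is smallest. Activity is
    thus decided by \<open>C\<close> alone.\<close>
  have weight1: "weight (C \<union> B) e = (if ?L then Y e else y e)" if "B \<subseteq> U'" for B
  proof -
    have "e \<notin> C \<union> B" using that eU' eC by auto
    moreover have "externally_active G H \<phi> (C \<union> B) e \<longleftrightarrow> ?L"
    proof
      assume "externally_active G H \<phi> (C \<union> B) e"
      then obtain F where F: "is_cycle G F" "F \<subseteq> (C \<union> B) \<union> {e}" "\<forall>f\<in>F. \<phi> e \<le> \<phi> f"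
        unfolding externally_active_def by blast
      moreover have "F \<inter> B = {}"
        using F(3) lt that by (fastforce simp: not_less[symmetric])
      ultimately show ?L by blast
    next
      assume ?L
      then obtain F where F: "is_cycle G F" "F \<subseteq> insert e C" by blast
      moreover have "e \<in> F" using F Suc.prems(4) by blast
      moreover have "\<phi> e \<le> \<phi> f" if "f \<in> F" for f
        using that F(2) gt[of f] Suc.prems(2) by auto
      ultimately show "externally_active G H \<phi> (C \<union> B) e"
        using e_reg \<open>e \<notin> C \<union> B\<close> unfolding externally_active_def by blast
    qed
    ultimately show ?thesis by (simp add: weight_def)
  qed
  have weight2: "weight (insert e C \<union> B) e = (if ?B then X e else x e)" if "B \<subseteq> U'" for B
  proof -
    have "internally_active G H \<phi> (insert e C \<union> B) e \<longleftrightarrow> ?B"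
    proof
      assume "internally_active G H \<phi> (insert e C \<union> B) e"
      then obtain F where F: "is_cocycle G F" "F \<subseteq> (edges G - (insert e C \<union> B \<union> H)) \<union> {e}"
        "\<forall>f\<in>F. \<phi> e \<le> \<phi> f"
        unfolding internally_active_def by blast
      moreover have "F \<inter> U' = {}"
        using F(3) lt by (fastforce simp: not_less[symmetric])
      ultimately have "F \<subseteq> insert e ?D"
        using U by blast
      with F(1) show ?B by blast
    next
      assume ?B
      then obtain F where F: "is_cocycle G F" "F \<subseteq> insert e ?D" by blast
      moreover have "e \<in> F" using F Suc.prems(5) by blast
      moreover have "\<phi> e \<le> \<phi> f" if "f \<in> F" for f
        using that F(2) gt[of f] by auto
      moreover have "F \<subseteq> (edges G - (insert e C \<union> B \<union> H)) \<union> {e}"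
        using F(2) that U by blast
      ultimately show "internally_active G H \<phi> (insert e C \<union> B) e"
        unfolding internally_active_def by blast
    qed
    then show ?thesis by (simp add: weight_def)
  qed
  have "tutte_sum (insert e U') C = (if ?L then Y e else y e) * tutte_sum U' C +
      (if ?B then X e else x e) * tutte_sum U' (insert e C)"
    using finU' eU' eC weight1 weight2 by (intro tutte_sum_insert) auto
  note T = this[folded U]
  have Z: "state_sum U C = y e * state_sum U' C + x e * state_sum U' (insert e C)"
    unfolding U using finU' eU' by (rule state_sum_insert)
  have sub: "C \<union> B \<subseteq> regular" "e \<notin> C \<union> B" if "B \<in> Pow U'" for B
    using that Suc.prems(1,2) U eU' eC by auto
  consider ?L "\<not> ?B" | "\<not> ?L" ?B | "\<not> ?L" "\<not> ?B"
    using not_both by blast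
  then show ?case
  proof cases
    case 1
    then obtain F where F: "is_cycle G F" "F \<subseteq> insert e C" by blast
    then have "e \<in> F" using Suc.prems(4) by blast
    have "tutte_sum U' (insert e C) = 0"
      unfolding tutte_sum_def using F
      by (intro sum.neutral) (auto simp: contracting_sets_def)
    moreover have "state_sum U' (insert e C) = d * state_sum U' C"
      unfolding state_sum_def sum_distrib_left
    proof (rule sum.cong[OF refl])
      fix B assume B: "B \<in> Pow U'"
      have "k (insert e (C \<union> B)) = k (C \<union> B) + 1"
        using sub[OF B] e_reg F \<open>e \<in> F\<close> by (intro loop[of _ _ F]) auto
      \<comment> \<open>The exponent \<open>k - 1\<close> is truncated; positivity of
        \<open>k\<close> ensures that it really rises by one.\<close>
      moreover obtain m where "k (C \<union> B) = Suc m"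
        using k_pos[OF sub(1)[OF B]] by (metis gr0_implies_Suc)
      ultimately show "(\<Prod>a\<in>U'. if a \<in> B then x a else y a) * d ^ (k (insert e C \<union> B) - 1) =
          d * ((\<Prod>a\<in>U'. if a \<in> B then x a else y a) * d ^ (k (C \<union> B) - 1))"
        by simp
    qed
    ultimately show ?thesis
      using 1 by (simp add: T Z IH1 Y_eq[OF e_reg] algebra_simps)
  next
    case 2
    then obtain F where F: "is_cocycle G F" "F \<subseteq> insert e ?D" by blast
    then have "e \<in> F" using Suc.prems(5) by blast
    have "C \<union> B \<notin> contracting_sets G H" if "B \<in> Pow U'" for B
    proof -
      have "insert e ?D \<subseteq> edges G - (C \<union> B \<union> H)"
        using that U e_reg sub(2)[OF that] by auto
      then show ?thesis
        using F unfolding contracting_sets_def by blast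
    qed
    then have "tutte_sum U' C = 0"
      unfolding tutte_sum_def by (intro sum.neutral) auto
    moreover have "state_sum U' C = d * state_sum U' (insert e C)"
      unfolding state_sum_def sum_distrib_left
    proof (rule sum.cong[OF refl])
      fix B assume B: "B \<in> Pow U'"
      have "insert e ?D \<subseteq> regular - (C \<union> B)"
        using B U e_reg sub(2)[OF B] by auto
      then have "k (C \<union> B) = k (insert e (C \<union> B)) + 1"
        using sub[OF B] e_reg F \<open>e \<in> F\<close> by (intro bridge[of _ _ F]) auto
      moreover obtain m where "k (insert e (C \<union> B)) = Suc m"
        using k_pos[of "insert e (C \<union> B)"] sub(1)[OF B] e_reg
        by (metis gr0_implies_Suc insert_subset)
      ultimately show "(\<Prod>a\<in>U'. if a \<in> B then x a else y a) * d ^ (k (C \<union> B) - 1) =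
          d * ((\<Prod>a\<in>U'. if a \<in> B then x a else y a) * d ^ (k (insert e C \<union> B) - 1))"
        by simp
    qed
    ultimately show ?thesis
      using 2 by (simp add: T Z IH2 X_eq[OF e_reg] algebra_simps)
  next
    case 3
    then show ?thesis unfolding T Z IH1[OF 3(2)] IH2[OF 3(1)] by (simp only: if_False)
  qed
qed

theorem tutte_expansion:
  "(\<Sum>C\<in>contracting_sets G H. (\<Prod>e\<in>regular. weight C e) * d ^ (k C - 1)) =
   (\<Sum>B\<in>Pow regular. (\<Prod>e\<in>regular. if e \<in> B then x e else y e) * d ^ (k B - 1))"
proof -
  have "\<nexists>F. is_cycle G F \<and> F \<subseteq> {}"
    by (auto simp: is_cycle_def)
  moreover have "\<nexists>F. is_cocycle G F \<and> F \<subseteq> {}"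
    by (auto simp: is_cocycle_def separating_def)
  ultimately have "tutte_sum regular {} = state_sum regular {}"
    by (intro tutte_sum_eq_state_sum) auto
  moreover have "contracting_sets G H = {C \<in> Pow regular. C \<in> contracting_sets G H}"
    by (auto simp: contracting_sets_def)
  then have "tutte_sum regular {} =
      (\<Sum>C\<in>contracting_sets G H. (\<Prod>e\<in>regular. weight C e) * d ^ (k C - 1))"
    unfolding tutte_sum_def using finite_regular by (simp add: sum.inter_filter[symmetric])
  ultimately show ?thesis
    by (simp add: state_sum_def)
qed

end

section \<open>Coboundaries on planar diagrams\<close>

lemma even_card_sym_diff_inter:
  assumes "finite v"
  shows "odd (card (sym_diff A B \<inter> v)) \<longleftrightarrow> odd (card (A \<inter> v)) \<noteq> odd (card (B \<inter> v))"
proof -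
  have "card (A \<inter> v) = card (A \<inter> B \<inter> v) + card ((A - B) \<inter> v)"
    using assms by (subst card_Un_disjoint[symmetric]) (auto intro: arg_cong[where f = card])
  moreover have "card (B \<inter> v) = card (A \<inter> B \<inter> v) + card ((B - A) \<inter> v)"
    using assms by (subst card_Un_disjoint[symmetric]) (auto intro: arg_cong[where f = card])
  moreover have "card (sym_diff A B \<inter> v) = card ((A - B) \<inter> v) + card ((B - A) \<inter> v)"
    using assms by (subst card_Un_disjoint[symmetric]) (auto intro: arg_cong[where f = card])
  ultimately show ?thesis by presburger
qed

lemma odd_meet_sym_diff:
  assumes "\<And>v. v \<in> W \<Longrightarrow> finite v"
  shows "{v \<in> W. odd (card (sym_diff A B \<inter> v))} =
    sym_diff {v \<in> W. odd (card (A \<inter> v))} {v \<in> W. odd (card (B \<inter> v))}"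
proof (rule set_eqI)
  fix v
  show "v \<in> {v \<in> W. odd (card (sym_diff A B \<inter> v))} \<longleftrightarrow>
      v \<in> sym_diff {v \<in> W. odd (card (A \<inter> v))} {v \<in> W. odd (card (B \<inter> v))}"
    using even_card_sym_diff_inter[OF assms, of v A B] by (cases "v \<in> W") auto
qed

lemma Plus_sym_diff: "sym_diff A B <+> sym_diff C D = sym_diff (A <+> C) (B <+> D)"
  by auto

locale link_diagram =
  fixes K :: "('d, 'r) diagram"
  assumes diagram: "virtual_link_diagram K"
begin

lemma finite_darts: "finite (darts K)" and darts_nonempty: "darts K \<noteq> {}"
  and arc_permutes: "arc K permutes darts K" and rot_permutes: "rot K permutes darts K"
  and arc_neq: "x \<in> darts K \<Longrightarrow> arc K x \<noteq> x" and arc_arc: "x \<in> darts K \<Longrightarrow> arc K (arc K x) = x"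
  and card_vertex: "v \<in> vertices K \<Longrightarrow> card v = 2 \<or> card v = 4"
  and region_face_step: "x \<in> darts K \<Longrightarrow> region K (face_step K x) = region K x"
  and genus: "Q \<in> pieces K \<Longrightarrow> genus_zero K Q" and tree: "is_tree (nesting_graph K)"
  and virt_crossings: "virt K \<subseteq> crossings K"
  and over_alternates: "x \<in> \<Union>(classical K) \<Longrightarrow> x \<in> over K \<longleftrightarrow> rot K x \<notin> over K"
  using diagram unfolding virtual_link_diagram_def by blast+

lemma face_step_permutes: "face_step K permutes darts K"
  unfolding face_step_def by (intro permutes_compose arc_permutes permutes_inv rot_permutes)

lemma rot_face_step: "rot K (face_step K x) = arc K x"
  by (simp add: face_step_def permutes_inverses[OF rot_permutes])

lemma arc_in: "arc K x \<in> darts K \<longleftrightarrow> x \<in> darts K"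
  and rot_in: "rot K x \<in> darts K \<longleftrightarrow> x \<in> darts K"
  by (simp_all add: permutes_in_image arc_permutes rot_permutes)

lemma orbit_facts:
  assumes "f permutes darts K"
  shows orbit_self: "x \<in> orbit f x"
    and orbit_eq: "y \<in> orbit f x \<Longrightarrow> orbit f y = orbit f x"
    and orbit_darts: "x \<in> darts K \<Longrightarrow> orbit f x \<subseteq> darts K"
    and orbit_app: "orbit f (f x) = orbit f x"
    and orbit_bij: "bij_betw f (orbit f x) (orbit f x)"
proof -
  have perm: "permutation f"
    using assms finite_darts by (auto simp: permutation_permutes)
  show "x \<in> orbit f x" by (rule permutation_self_in_orbit[OF perm])
  show eq: "orbit f y = orbit f x" if "y \<in> orbit f x" for y
    using that by (intro orbit_cyclic_eq3[OF cyclic_on_orbit'[OF perm]])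
  show "x \<in> darts K \<Longrightarrow> orbit f x \<subseteq> darts K"
    by (rule permutes_orbit_subset[OF assms])
  show app: "orbit f (f x) = orbit f x" by (rule permutation_orbit_step[OF perm])
  show "bij_betw f (orbit f x) (orbit f x)"
  proof (rule bij_betw_imageI)
    show inj: "inj_on f (orbit f x)"
      using permutes_inj[OF assms] by (rule inj_on_subset) auto
    have "finite (orbit f x)"
      using permutation_self_in_orbit[OF perm] by (rule finite_orbit)
    moreover have "f ` orbit f x \<subseteq> orbit f x"
      by (auto intro: orbit.step)
    ultimately show "f ` orbit f x = orbit f x"
      using inj by (simp add: card_image card_subset_eq)
  qed
qed

lemma funpow_card_orbit:
  assumes "f permutes darts K"
  shows "(f ^^ card (orbit f x)) x = x"
    and "orbit f x = (\<lambda>n. (f ^^ n) x) ` {..<card (orbit f x)}"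
    and "inj_on (\<lambda>n. (f ^^ n) x) {..<card (orbit f x)}"
proof -
  let ?n = "funpow_dist1 f x x"
  have self: "x \<in> orbit f x" by (rule orbit_self[OF assms])
  have inj: "inj_on (\<lambda>n. (f ^^ n) x) {0..<?n}"
    by (rule inj_on_funpow_dist1[OF self])
  have im: "orbit f x = (\<lambda>n. (f ^^ n) x) ` {0..<?n}"
    by (rule orbit_conv_funpow_dist1[OF self])
  have n: "card (orbit f x) = ?n"
    unfolding im using inj by (simp add: card_image)
  show "(f ^^ card (orbit f x)) x = x"
    unfolding n by (rule funpow_dist1_prop[OF self])
  show "orbit f x = (\<lambda>n. (f ^^ n) x) ` {..<card (orbit f x)}"
    using im unfolding n by (simp add: atLeast0LessThan)
  show "inj_on (\<lambda>n. (f ^^ n) x) {..<card (orbit f x)}"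
    using inj unfolding n by (simp add: atLeast0LessThan)
qed

section \<open>Vertices, arcs and pieces as orbits and classes of darts\<close>

lemma vertex_eq_orbit: "v \<in> vertices K \<Longrightarrow> x \<in> v \<Longrightarrow> v = orbit (rot K) x"
  using orbit_eq[OF rot_permutes] by (auto simp: vertices_def)

lemma crossing_cases:
  assumes "c \<in> crossings K" "x \<in> c"
  shows "c = {x, rot K x, rot K (rot K x), rot K (rot K (rot K x))}"
    and "distinct [x, rot K x, rot K (rot K x), rot K (rot K (rot K x))]"
    and "rot K (rot K (rot K (rot K x))) = x"
proof -
  have c: "c = orbit (rot K) x" "card c = 4"
    using assms vertex_eq_orbit by (auto simp: crossings_def)
  have 4: "{..<4::nat} = {0, 1, 2, 3}" by auto
  note * = funpow_card_orbit[OF rot_permutes, of x, folded c(1), unfolded c(2)]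
  show "c = {x, rot K x, rot K (rot K x), rot K (rot K (rot K x))}"
    using *(2) unfolding 4 by (simp add: numeral_eq_Suc)
  show "distinct [x, rot K x, rot K (rot K x), rot K (rot K (rot K x))]"
    using *(3) unfolding 4 by (simp add: numeral_eq_Suc) 
  show "rot K (rot K (rot K (rot K x))) = x"
    using *(1) by (simp add: numeral_eq_Suc)
qed

lemma base_point_cases:
  assumes "v \<in> base_points K" "x \<in> v"
  shows "v = {x, rot K x}" and "rot K x \<noteq> x" and "rot K (rot K x) = x"
proof -
  have v: "v = orbit (rot K) x" "card v = 2"
    using assms vertex_eq_orbit by (auto simp: base_points_def)
  have 2: "{..<2::nat} = {0, 1}" by auto
  note * = funpow_card_orbit[OF rot_permutes, of x, folded v(1), unfolded v(2)]
  show "v = {x, rot K x}"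
    using *(2) by (simp add: 2)
  show "rot K x \<noteq> x"
    using *(3) unfolding 2 by simp
  show "rot K (rot K x) = x"
    using *(1) by (simp add: numeral_eq_Suc)
qed

definition adjacency :: "('d \<times> 'd) set" where
  "adjacency = (\<lambda>x. (x, arc K x)) ` darts K \<union> (\<lambda>x. (x, rot K x)) ` darts K"

lemma piece_memD:
  assumes "Q \<in> pieces K"
  shows "Q \<subseteq> darts K" and "\<And>x. arc K x \<in> Q \<longleftrightarrow> x \<in> Q" and "\<And>x. rot K x \<in> Q \<longleftrightarrow> x \<in> Q"
    and "\<And>q. q \<in> Q \<Longrightarrow> Q = (adjacency \<union> adjacency\<inverse>)\<^sup>* `` {q}"
    and "Q \<noteq> {}"
proof -
  let ?r = "(adjacency \<union> adjacency\<inverse>)\<^sup>*"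
  obtain q where q: "q \<in> darts K" "Q = ?r `` {q}"
    using assms by (auto simp: pieces_def adjacency_def connected_classes_def quotient_def)
  show "Q \<noteq> {}" using q by auto
  have "(a \<in> darts K) = (b \<in> darts K)" if "(a, b) \<in> adjacency" for a b
    using that by (auto simp: adjacency_def arc_in rot_in)
  then show sub: "Q \<subseteq> darts K"
    using q symcl_preserves[where h = "\<lambda>x. x \<in> darts K" and R = adjacency] by blast
  have *: "a \<in> Q \<longleftrightarrow> b \<in> Q" if "(a, b) \<in> adjacency" for a b
    using that unfolding q(2) by (auto intro: rtrancl_into_rtrancl)
  show "arc K x \<in> Q \<longleftrightarrow> x \<in> Q" for x
    using *[of x "arc K x"] sub arc_in by (auto simp: adjacency_def)
  show "rot K x \<in> Q \<longleftrightarrow> x \<in> Q" for x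
    using *[of x "rot K x"] sub rot_in by (auto simp: adjacency_def)
  show "Q = ?r `` {x}" if "x \<in> Q" for x
    using that q(2) equiv_symcl[of adjacency] by (auto simp: equiv_class_eq_iff)
qed

lemma face_step_in_piece: "Q \<in> pieces K \<Longrightarrow> face_step K x \<in> Q \<longleftrightarrow> x \<in> Q"
  using piece_memD(2,3)[of Q] rot_face_step by metis

lemma orbit_in_piece:
  assumes "f permutes darts K" "\<And>x. f x \<in> Q \<longleftrightarrow> x \<in> Q"
  shows "orbit f x \<subseteq> Q \<longleftrightarrow> x \<in> Q"
proof
  assume "x \<in> Q"
  have "y \<in> Q" if "y \<in> orbit f x" for y
    using that by induction (use assms(2) \<open>x \<in> Q\<close> in auto)
  then show "orbit f x \<subseteq> Q" by blast
qed (use orbit_self[OF assms(1)] in blast)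

lemma orbits_in_piece:
  assumes "f permutes darts K" "Q \<in> pieces K" "\<And>x. f x \<in> Q \<longleftrightarrow> x \<in> Q"
  shows "{v \<in> orbit f ` darts K. v \<subseteq> Q} = orbit f ` Q"
  using orbit_in_piece[OF assms(1,3)] piece_memD(1)[OF assms(2)] by auto

lemma arc_orbit:
  assumes "x \<in> darts K"
  shows "orbit (arc K) x = {x, arc K x}"
proof
  show "orbit (arc K) x \<subseteq> {x, arc K x}"
  proof
    fix y assume "y \<in> orbit (arc K) x"
    then show "y \<in> {x, arc K x}"
      by induction (use arc_arc[OF assms] in auto)
  qed
qed (use orbit_self[OF arc_permutes] in \<open>auto intro: orbit.base\<close>)

lemma card_piece:
  assumes "Q \<in> pieces K"
  shows "card Q = 2 * card (orbit (arc K) ` Q)"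
proof -
  have Q: "Q \<subseteq> darts K" "\<And>x. arc K x \<in> Q \<longleftrightarrow> x \<in> Q"
    using piece_memD[OF assms] by blast+
  have "finite Q" using Q(1) finite_darts by (rule finite_subset)
  have "2 * card (orbit (arc K) ` Q) = card (\<Union>(orbit (arc K) ` Q))"
  proof (rule card_partition)
    show "finite (\<Union>(orbit (arc K) ` Q))"
      using \<open>finite Q\<close> Q arc_orbit by auto
    show "card c = 2" if "c \<in> orbit (arc K) ` Q" for c
      using that Q(1) arc_orbit arc_neq by fastforce
    show "c \<inter> c' = {}" if "c \<in> orbit (arc K) ` Q" "c' \<in> orbit (arc K) ` Q" "c \<noteq> c'" for c c'
      using that orbit_eq[OF arc_permutes] by blast
  qed (use \<open>finite Q\<close> in auto)
  also have "\<Union>(orbit (arc K) ` Q) = (\<Union>x\<in>Q. {x, arc K x})"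
    using Q(1) arc_orbit by (intro SUP_cong) auto
  also have "\<dots> = Q"
    using Q(2) by auto
  finally show ?thesis by simp
qed

text \<open>
  The first homology of the sphere vanishes. In terms of dimensions over the field with two elements:
  the coboundaries have dimension at least \<open>e - 1\<close>, and by Euler's formula \<open>v + f = e + 2\<close> the
  boundary conditions have rank at least \<open>v + f - 1 = e + 1\<close> in a space of dimension \<open>2 * e\<close>.
\<close>

lemma genus_zero_coboundary:
  assumes Q: "Q \<in> pieces K" and X: "X \<subseteq> Q"
    and vertex: "\<And>v. v \<in> vertices K \<Longrightarrow> even (card (X \<inter> v))"
    and face: "\<And>f. f \<in> faces K \<Longrightarrow> even (card (X \<inter> f))"
  obtains P where "\<And>x. x \<in> Q \<Longrightarrow> arc K x \<in> P \<longleftrightarrow> x \<in> P"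
    "\<And>x. x \<in> Q \<Longrightarrow> x \<in> X \<longleftrightarrow> (x \<in> P) \<noteq> (rot K x \<in> P)"
proof -
  let ?e = "orbit (arc K)" and ?v = "orbit (rot K)" and ?f = "orbit (face_step K)"
  note pQ = piece_memD[OF Q]
  have connected: "(x, y) \<in> (adjacency \<union> adjacency\<inverse>)\<^sup>*" if "x \<in> Q" "y \<in> Q" for x y
    using that(2) unfolding pQ(4)[OF that(1)] by simp
  have finQ: "finite Q" using pQ(1) finite_darts by (rule finite_subset)
  have finv: "finite (?v x)" "finite (?f x)" if "x \<in> Q" for x
    using that pQ(1) finite_subset[OF orbit_darts[OF rot_permutes] finite_darts]
      finite_subset[OF orbit_darts[OF face_step_permutes] finite_darts] by auto
  have euler: "card (?v ` Q) + card (?f ` Q) = card (?e ` Q) + 2"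
    using genus[OF Q] orbits_in_piece[OF arc_permutes Q pQ(2)] orbits_in_piece[OF rot_permutes Q pQ(3)]
      orbits_in_piece[OF face_step_permutes Q face_step_in_piece[OF Q]]
    by (simp add: genus_zero_def arcs_def vertices_def faces_def)
  \<comment> \<open>A dart also stands for its corner. \<open>\<delta> A\<close> collects the
    corners of \<open>Q\<close> with exactly one of their two bounding arcs in \<open>A\<close>;
    \<open>\<sigma> Z\<close> lists the vertices and faces that violate the parity condition for
    \<open>Z\<close>. The goal is that the kernel of \<open>\<sigma>\<close> is the image of
    \<open>\<delta>\<close>.\<close>
  define \<delta> where "\<delta> A = {x \<in> Q. (?e x \<in> A) \<noteq> (?e (rot K x) \<in> A)}" for A
  define \<sigma> where "\<sigma> Z = {v \<in> ?v ` Q. odd (card (Z \<inter> v))} <+>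
    {f \<in> ?f ` Q. odd (card (Z \<inter> f))}" for Z
  define N where "N = ?v ` Q <+> ?f ` Q"

  have card_\<delta>: "2 ^ card (?e ` Q) = card {A \<in> Pow (?e ` Q). \<delta> A = {}} * card (\<delta> ` Pow (?e ` Q))"
    using finQ by (intro card_kernel_image) (auto simp: \<delta>_def)
  have "card {A \<in> Pow (?e ` Q). \<delta> A = {}} \<le> card {{}, ?e ` Q}"
  proof (rule card_mono)
    show "{A \<in> Pow (?e ` Q). \<delta> A = {}} \<subseteq> {{}, ?e ` Q}"
    proof
      fix A assume "A \<in> {A \<in> Pow (?e ` Q). \<delta> A = {}}"
      then have A: "A \<subseteq> ?e ` Q" "\<delta> A = {}" by auto
      \<comment> \<open>Vacuous truth outside \<open>Q\<close> lets the property be transported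
        along the adjacency of the whole diagram.\<close>
      define h where "h x \<longleftrightarrow> x \<in> Q \<longrightarrow> ?e x \<in> A" for x
      have "?e (rot K x) \<in> A \<longleftrightarrow> ?e x \<in> A" if "x \<in> Q" for x
        using that A(2) unfolding \<delta>_def by blast
      then have const: "h a = h b" if "(a, b) \<in> adjacency" for a b
        using that pQ(2,3) orbit_app[OF arc_permutes] by (auto simp: adjacency_def h_def)
      have "?e x \<in> A \<longleftrightarrow> ?e y \<in> A" if "x \<in> Q" "y \<in> Q" for x y
        using symcl_preserves[of x y adjacency h, OF connected[OF that] const] that by (simp add: h_def)
      then have "?e ` Q \<subseteq> A" if "a \<in> A" for a
        using A(1) that by blast
      with A(1) show "A \<in> {{}, ?e ` Q}" by auto
    qed
  qed simp
  also have "\<dots> \<le> 2"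
    by (simp add: card_insert_if)
  finally have lower: "2 ^ card (?e ` Q) \<le> 2 * card (\<delta> ` Pow (?e ` Q))"
    unfolding card_\<delta> by (rule mult_le_mono1)

  have \<sigma>_add: "\<sigma> (sym_diff A B) = sym_diff (\<sigma> A) (\<sigma> B)" for A B
  proof -
    have "{w \<in> ?v ` Q. odd (card (sym_diff A B \<inter> w))} =
        sym_diff {w \<in> ?v ` Q. odd (card (A \<inter> w))} {w \<in> ?v ` Q. odd (card (B \<inter> w))}"
      by (rule odd_meet_sym_diff) (use finv(1) in blast)
    moreover have "{w \<in> ?f ` Q. odd (card (sym_diff A B \<inter> w))} =
        sym_diff {w \<in> ?f ` Q. odd (card (A \<inter> w))} {w \<in> ?f ` Q. odd (card (B \<inter> w))}"
      by (rule odd_meet_sym_diff) (use finv(2) in blast)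
    ultimately show ?thesis
      unfolding \<sigma>_def by (simp only: Plus_sym_diff)
  qed
  have finN: "finite N" using finQ by (simp add: N_def)
  have cardN: "card N = card (?e ` Q) + 2"
    unfolding N_def using finQ euler by (simp add: card_Plus)
  define I where "I = \<sigma> ` Pow Q"
  have I_add: "sym_diff a b \<in> I" if "a \<in> I" "b \<in> I" for a b
  proof -
    from that obtain A B where "A \<subseteq> Q" "B \<subseteq> Q" "a = \<sigma> A" "b = \<sigma> B"
      unfolding I_def by blast
    then have "sym_diff a b = \<sigma> (sym_diff A B)" "sym_diff A B \<in> Pow Q"
      using \<sigma>_add by auto
    then show ?thesis unfolding I_def by blast
  qed
  have I_empty: "{} \<in> I"
    unfolding I_def by (rule image_eqI[of _ _ "{}"]) (auto simp: \<sigma>_def)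
  \<comment> \<open>A single corner lies at one vertex and on one face and changes exactly these two
    parities.\<close>
  have step: "{Inl (?v x), Inr (?f x)} \<in> I" if "x \<in> Q" for x
  proof -
    have "odd (card ({x} \<inter> w)) \<longleftrightarrow> x \<in> w" for w
      by (cases "x \<in> w") simp_all
    moreover have "x \<in> w \<longleftrightarrow> w = ?v x" if "w \<in> ?v ` Q" for w
      using that orbit_eq[OF rot_permutes] orbit_self[OF rot_permutes] by blast
    moreover have "x \<in> w \<longleftrightarrow> w = ?f x" if "w \<in> ?f ` Q" for w
      using that orbit_eq[OF face_step_permutes] orbit_self[OF face_step_permutes] by blast
    ultimately have "{v \<in> ?v ` Q. odd (card ({x} \<inter> v))} = {?v x}"
      "{f \<in> ?f ` Q. odd (card ({x} \<inter> f))} = {?f x}"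
      using that by blast+
    then have "\<sigma> {x} = {Inl (?v x), Inr (?f x)}"
      unfolding \<sigma>_def by auto
    moreover have "{x} \<in> Pow Q" using that by simp
    ultimately show ?thesis
      unfolding I_def by (metis image_eqI)
  qed
  obtain q where q: "q \<in> Q" using pQ(5) by blast
  \<comment> \<open>\<open>near n\<close> says that \<open>n\<close> and the base vertex can be
    toggled together. By connectedness of the piece this holds for every vertex and face, so at most
    one parity relation limits the image of \<open>\<sigma>\<close>.\<close>
  define near where "near n \<longleftrightarrow> sym_diff {n} {Inl (?v q)} \<in> I" for n
  have near_face: "near (Inl (?v x)) \<longleftrightarrow> near (Inr (?f x))" if "x \<in> Q" for x
  proof -
    have eq: "sym_diff (sym_diff {Inl (?v x)} c) {Inl (?v x), Inr (?f x)} = sym_diff {Inr (?f x)} c"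
      "sym_diff (sym_diff {Inr (?f x)} c) {Inl (?v x), Inr (?f x)} = sym_diff {Inl (?v x)} c" for c
      by auto
    show ?thesis
      unfolding near_def using I_add[OF _ step[OF that]] eq by metis
  qed
  define h where "h x \<longleftrightarrow> x \<in> Q \<longrightarrow> near (Inl (?v x))" for x
  have "h a = h b" if "(a, b) \<in> adjacency" for a b
  proof -
    \<comment> \<open>The far end of \<open>a\<close> is the vertex of \<open>face_step K a\<close>,
      which lies on the face of \<open>a\<close>; passing from vertex to face to vertex therefore
      crosses the arc.\<close>
    have "near (Inl (?v (arc K a))) \<longleftrightarrow> near (Inl (?v a))" if "a \<in> Q"
      using near_face[OF that] near_face[of "face_step K a"] that face_step_in_piece[OF Q]
        orbit_app[OF rot_permutes, of "face_step K a"] orbit_app[OF face_step_permutes, of a]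
      by (simp add: rot_face_step)
    then show ?thesis
      using that pQ(2,3) orbit_app[OF rot_permutes] by (auto simp: adjacency_def h_def)
  qed
  then have "h q = h x" if "x \<in> Q" for x
    using symcl_preserves[OF connected[OF q that], of h] by blast
  moreover have "h q" using I_empty by (simp add: h_def near_def)
  ultimately have "near n" if "n \<in> N" for n
    using that near_face by (auto simp: N_def h_def)
  then have all_near: "sym_diff {n} {Inl (?v q)} \<in> I" if "n \<in> N" for n
    using that by (simp add: near_def)
  have surj: "\<exists>B\<in>I. B - {Inl (?v q)} = A" if "A \<subseteq> N - {Inl (?v q)}" for A
    using finite_subset[OF that finite_Diff[OF finN]] that
  proof (induction A rule: finite_induct)
    case empty
    show ?case using I_empty by blast
  next
    case (insert n A)
    then obtain B where B: "B \<in> I" "B - {Inl (?v q)} = A" by auto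
    have "sym_diff B (sym_diff {n} {Inl (?v q)}) \<in> I"
      using insert.prems by (intro I_add B(1) all_near) auto
    moreover have "sym_diff B (sym_diff {n} {Inl (?v q)}) - {Inl (?v q)} = insert n A"
      using B(2) insert by auto
    ultimately show ?case by blast
  qed
  have "Inl (?v q) \<in> N"
    using q unfolding N_def by (intro InlI imageI)
  have pow_sub: "Pow (N - {Inl (?v q)}) \<subseteq> (\<lambda>B. B - {Inl (?v q)}) ` I"
  proof
    fix A assume "A \<in> Pow (N - {Inl (?v q)})"
    then obtain B where "B \<in> I" "B - {Inl (?v q)} = A"
      using surj by (metis PowD)
    then show "A \<in> (\<lambda>B. B - {Inl (?v q)}) ` I"
      by (metis image_eqI)
  qed
  from \<open>Inl (?v q) \<in> N\<close> have "2 ^ (card N - 1) = card (Pow (N - {Inl (?v q)}))"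
    using finN by (simp add: card_Pow)
  also have "\<dots> \<le> card ((\<lambda>B. B - {Inl (?v q)}) ` I)"
    using pow_sub finQ by (intro card_mono) (simp_all add: I_def)
  also have "\<dots> \<le> card I"
    using finQ by (intro card_image_le) (simp add: I_def)
  finally have "2 * 2 ^ card (?e ` Q) \<le> card I"
    by (simp add: cardN)
  moreover have kernel: "2 ^ card Q = card {Z \<in> Pow Q. \<sigma> Z = {}} * card I"
    unfolding I_def using finQ \<sigma>_add by (rule card_kernel_image)
  \<comment> \<open>With \<open>e\<close> arcs, the kernel of \<open>\<sigma>\<close> has at most
    \<open>2 ^ (2 * e) / 2 ^ (e + 1)\<close> elements, which is the lower bound
    \<open>2 ^ e / 2\<close> for the image of \<open>\<delta>\<close>.\<close>
  ultimately have "card {Z \<in> Pow Q. \<sigma> Z = {}} * (2 * 2 ^ card (?e ` Q)) \<le> 2 ^ card Q"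
    unfolding kernel by (intro mult_le_mono2)
  also have "\<dots> = 2 ^ card (?e ` Q) * 2 ^ card (?e ` Q)"
    by (simp add: card_piece[OF Q] mult_2 power_add)
  finally have "card {Z \<in> Pow Q. \<sigma> Z = {}} * 2 \<le> 2 ^ card (?e ` Q)"
    by (simp add: mult.assoc[symmetric])
  with lower have le: "card {Z \<in> Pow Q. \<sigma> Z = {}} \<le> card (\<delta> ` Pow (?e ` Q))"
    by linarith

  have "\<delta> A \<in> {Z \<in> Pow Q. \<sigma> Z = {}}" for A
  proof -
    have "even (card (\<delta> A \<inter> ?v x))" if "x \<in> Q" for x
    proof -
      have "?v x \<subseteq> Q" using that orbit_in_piece[OF rot_permutes pQ(3)] by blast
      then have "\<delta> A \<inter> ?v x = {y \<in> ?v x. (?e y \<in> A) \<noteq> (?e (rot K y) \<in> A)}"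
        by (auto simp: \<delta>_def)
      then show ?thesis
        using even_card_changes[OF finv(1)[OF that] orbit_bij[OF rot_permutes], of "\<lambda>y. ?e y \<in> A"]
        by simp
    qed
    \<comment> \<open>Consecutive corners of a face share an arc:
      \<open>rot K (face_step K y)\<close> is \<open>arc K y\<close>. Hence membership in
      \<open>\<delta> A\<close> is a change of the label of \<open>rot K y\<close> along
      \<open>face_step\<close>.\<close>
    moreover have "even (card (\<delta> A \<inter> ?f x))" if "x \<in> Q" for x
    proof -
      have "?f x \<subseteq> Q"
        using that orbit_in_piece[OF face_step_permutes face_step_in_piece[OF Q]] by blast
      then have "\<delta> A \<inter> ?f x =
          {y \<in> ?f x. (?e (rot K y) \<in> A) \<noteq> (?e (rot K (face_step K y)) \<in> A)}"
        by (auto simp: \<delta>_def rot_face_step orbit_app[OF arc_permutes])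
      then show ?thesis
        using even_card_changes[OF finv(2)[OF that] orbit_bij[OF face_step_permutes],
            of "\<lambda>y. ?e (rot K y) \<in> A"] by simp
    qed
    ultimately show ?thesis by (auto simp: \<sigma>_def \<delta>_def)
  qed
  then have "\<delta> ` Pow (?e ` Q) \<subseteq> {Z \<in> Pow Q. \<sigma> Z = {}}" by blast
  then have image_\<delta>: "\<delta> ` Pow (?e ` Q) = {Z \<in> Pow Q. \<sigma> Z = {}}"
    using le finQ by (intro card_seteq) auto
  have "\<sigma> X = {}"
    using vertex face pQ(1) unfolding \<sigma>_def vertices_def faces_def by blast
  then have "X \<in> \<delta> ` Pow (?e ` Q)"
    unfolding image_\<delta> using X by simp
  then obtain A where "X = \<delta> A" by (rule imageE)
  show ?thesis
  proof (rule that[of "{x. ?e x \<in> A}"])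
    show "x \<in> X \<longleftrightarrow> (x \<in> {x. ?e x \<in> A}) \<noteq> (rot K x \<in> {x. ?e x \<in> A})" if "x \<in> Q" for x
      using that \<open>X = \<delta> A\<close> by (simp add: \<delta>_def)
  qed (simp add: orbit_app[OF arc_permutes])
qed

end

section \<open>Smoothing one crossing\<close>

context link_diagram
begin

lemma vertex_of: "x \<in> darts K \<Longrightarrow> orbit (rot K) x \<in> vertices K"
  by (simp add: vertices_def)

lemma vertex_unique: "v \<in> vertices K \<Longrightarrow> w \<in> vertices K \<Longrightarrow> x \<in> v \<Longrightarrow> x \<in> w \<Longrightarrow> v = w"
  using vertex_eq_orbit by metis

lemma vertex_darts: "v \<in> vertices K \<Longrightarrow> v \<subseteq> darts K"
  using orbit_darts[OF rot_permutes] by (auto simp: vertices_def)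

lemma rot_in_vertex: "v \<in> vertices K \<Longrightarrow> rot K x \<in> v \<longleftrightarrow> x \<in> v"
  using vertex_eq_orbit[of v] orbit_app[OF rot_permutes, of x] orbit_self[OF rot_permutes, of x]
    orbit_self[OF rot_permutes, of "rot K x"] by metis

lemma finite_vertex: "v \<in> vertices K \<Longrightarrow> finite v"
  using vertex_darts finite_darts finite_subset by blast

lemma vertex_kinds:
  shows "base_points K \<subseteq> vertices K" "crossings K \<subseteq> vertices K" "virt K \<subseteq> vertices K"
    "classical K \<subseteq> vertices K" "classical K \<subseteq> crossings K"
    "base_points K \<inter> crossings K = {}" "classical K \<inter> virt K = {}"
    "vertices K = base_points K \<union> virt K \<union> classical K"
  using virt_crossings card_vertex by (auto simp: base_points_def crossings_def classical_def)

lemma finite_crossings: "finite (crossings K)"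
  using finite_darts by (auto simp: crossings_def vertices_def)

text \<open>The relation inside \<open>curves\<close>, named because it is also used for
  \<open>M \<union> c\<close>: then no links remain at the crossing \<open>c\<close> and the curves
  are cut open there.\<close>

definition joins :: "'d set \<Rightarrow> ('d \<times> 'd) set" where
  "joins M = (\<lambda>x. (x, arc K x)) ` darts K \<union>
      (\<lambda>x. (x, rot K x)) ` \<Union>(base_points K) \<union>
      (\<lambda>x. (x, rot K (rot K x))) ` \<Union>(virt K) \<union>
      (\<lambda>x. (x, rot K x)) ` (\<Union>(classical K) - M)"

abbreviation linked :: "'d set \<Rightarrow> ('d \<times> 'd) set" where
  "linked M \<equiv> (joins M \<union> (joins M)\<inverse>)\<^sup>*"

lemma linked_sym: "(x, y) \<in> linked M \<Longrightarrow> (y, x) \<in> linked M"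
  using equiv_symcl[of "joins M"] by (auto simp: equiv_def dest: symD)

lemma linked_trans: "(x, y) \<in> linked M \<Longrightarrow> (y, z) \<in> linked M \<Longrightarrow> (x, z) \<in> linked M"
  by (rule rtrancl_trans)

text \<open>At every classical crossing \<open>M\<close> holds exactly two opposite corners, that
  is, it prescribes a genuine smoothing.\<close>

definition alternating :: "'d set \<Rightarrow> bool" where
  "alternating M \<longleftrightarrow> (\<forall>x\<in>\<Union>(classical K). x \<in> M \<longleftrightarrow> rot K x \<notin> M)"

text \<open>
  With the crossing \<open>c\<close> removed, the curves become closed curves and arcs with end points in \<open>c\<close>;
  by parity a component contains an even number of these end points.
\<close>

lemma loose_end:
  assumes M: "alternating M" and c: "c \<in> classical K" and x: "x \<in> c"
  obtains w where "w \<in> c" "w \<noteq> x" "(x, w) \<in> linked (M \<union> c)"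
proof -
  define Z where "Z = {w \<in> darts K. (x, w) \<in> linked (M \<union> c)}"
  have c_vert: "c \<in> vertices K" "c \<notin> base_points K" "c \<notin> virt K"
    using c vertex_kinds by auto
  have fin: "finite Z" unfolding Z_def using finite_darts by simp
  have closed: "b \<in> Z \<longleftrightarrow> a \<in> Z" if "(a, b) \<in> joins (M \<union> c)" "a \<in> darts K" "b \<in> darts K" for a b
  proof -
    have "(a, b) \<in> linked (M \<union> c)" using that(1) by auto
    then show ?thesis
      using that linked_sym linked_trans unfolding Z_def by blast
  qed
  have "even (card Z)"
  proof (rule even_card_involution[OF fin, of "arc K"])
    fix w assume "w \<in> Z"
    then have "w \<in> darts K" by (simp add: Z_def)
    then show "arc K w \<in> Z \<and> arc K (arc K w) = w \<and> arc K w \<noteq> w"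
      using closed[of w "arc K w"] \<open>w \<in> Z\<close> arc_arc arc_neq arc_in by (auto simp: joins_def)
  qed
  \<comment> \<open>Away from \<open>c\<close>, \<open>\<tau>\<close> sends a dart to its partner at
    the same vertex. If the corner of the dart is merged, the partner is its clockwise neighbor,
    reached by three applications of \<open>rot\<close>.\<close>
  define \<tau> where "\<tau> w = (if w \<in> \<Union>(base_points K) then rot K w
    else if w \<in> \<Union>(virt K) then rot K (rot K w)
    else if w \<in> M then rot K (rot K (rot K w)) else rot K w)" for w
  have "even (card (Z - c))"
  proof (rule even_card_involution[of _ \<tau>])
    fix w assume w: "w \<in> Z - c"
    then have wd: "w \<in> darts K" by (simp add: Z_def)
    define v where "v = orbit (rot K) w"
    have v: "v \<in> vertices K" "w \<in> v"
      using wd vertex_of orbit_self[OF rot_permutes] by (auto simp: v_def)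
    have "v \<inter> c = {}"
      using vertex_unique[OF v(1) c_vert(1)] v w by (metis DiffD2 disjoint_iff)
    then have off: "u \<notin> c" if "u \<in> v" for u
      using that by blast
    have only: "u \<in> \<Union>W \<longleftrightarrow> v \<in> W" if "W \<subseteq> vertices K" "u \<in> v" for u W
      using that vertex_unique[OF v(1)] by blast
    note in_v = rot_in_vertex[OF v(1)]
    have dv: "u \<in> darts K" if "u \<in> v" for u
      using that vertex_darts[OF v(1)] by blast
    consider (base) "v \<in> base_points K" | (virt) "v \<in> virt K" "v \<notin> base_points K"
      | (classical) "v \<in> classical K" "v \<notin> base_points K" "v \<notin> virt K"
      using v(1) vertex_kinds by blast
    then show "\<tau> w \<in> Z - c \<and> \<tau> (\<tau> w) = w \<and> \<tau> w \<noteq> w"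
    proof cases
      case base
      have \<tau>: "\<tau> u = rot K u" if "u \<in> v" for u
        using base that by (auto simp: \<tau>_def)
      have "(w, rot K w) \<in> joins (M \<union> c)"
        using base v(2) by (auto simp: joins_def)
      then show ?thesis
        using base_point_cases[OF base v(2)] \<tau> in_v v(2) off closed dv w by auto
    next
      case virt
      then have cr: "v \<in> crossings K" using virt_crossings by blast
      have \<tau>: "\<tau> u = rot K (rot K u)" if "u \<in> v" for u
        using virt that only[OF vertex_kinds(1) that] by (auto simp: \<tau>_def)
      have u: "rot K (rot K w) \<in> v" "rot K (rot K w) \<noteq> w"
        using crossing_cases(2)[OF cr v(2)] in_v v(2) by auto
      have "(w, rot K (rot K w)) \<in> joins (M \<union> c)"
        using virt v(2) by (auto simp: joins_def)
      then have "rot K (rot K w) \<in> Z"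
        using closed dv u(1) v(2) w by blast
      then show ?thesis
        using u \<tau> v(2) off crossing_cases(3)[OF cr v(2)] by simp
    next
      case classical
      then have cr: "v \<in> crossings K" by (simp add: classical_def)
      have \<tau>: "\<tau> u = (if u \<in> M then rot K (rot K (rot K u)) else rot K u)" if "u \<in> v" for u
        using classical that only[OF vertex_kinds(1) that] only[OF vertex_kinds(3) that]
        by (simp add: \<tau>_def)
      have alt: "rot K u \<in> M \<longleftrightarrow> u \<notin> M" if "u \<in> v" for u
        using M classical(1) that by (auto simp: alternating_def)
      have joined: "(u, rot K u) \<in> joins (M \<union> c)" if "u \<in> v" "u \<notin> M" for u
        using classical that off by (auto simp: joins_def)
      show ?thesis
      proof (cases "w \<in> M")
        case True
        let ?u = "rot K (rot K (rot K w))"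
        have u: "?u \<in> v" "?u \<notin> M" "rot K ?u = w" "?u \<noteq> w"
          using crossing_cases(2,3)[OF cr v(2)] in_v v(2) alt True by auto
        then have "?u \<in> Z"
          using closed[OF joined[OF u(1,2)]] dv u v(2) w by simp
        then show ?thesis
          using u \<tau> v(2) True off by simp
      next
        case False
        have u: "rot K w \<in> v" "rot K w \<in> M" "rot K w \<noteq> w"
          using crossing_cases(2)[OF cr v(2)] in_v v(2) alt False by auto
        then have "rot K w \<in> Z"
          using closed[OF joined[OF v(2) False]] dv u(1) w v(2) by simp
        then show ?thesis
          using u \<tau> v(2) False off crossing_cases(3)[OF cr v(2)] by simp
      qed
    qed
  qed (use fin in simp)
  moreover have "card Z = card (Z - c) + card (Z \<inter> c)"
    using fin by (metis card_Diff_subset_Int card_mono finite_Int inf_le1 le_add_diff_inverse2)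
  ultimately have "even (card (Z \<inter> c))"
    using \<open>even (card Z)\<close> by simp
  moreover have "x \<in> Z"
    using x vertex_darts[OF c_vert(1)] by (auto simp: Z_def)
  ultimately have "Z \<inter> c \<noteq> {x}" "x \<in> Z \<inter> c"
    using x by auto
  then obtain w where "w \<in> Z \<inter> c" "w \<noteq> x" by blast
  then show ?thesis using that by (auto simp: Z_def)
qed

text \<open>\<open>P\<close> plays the role of the inside of a curve that separates the two strands
  at \<open>c\<close>. With \<open>c\<close> cut open, parity links each of the four ends to another
  one, and \<open>P\<close> allows only the pairing that \<open>M\<close> itself makes. So
  \<open>M\<close> closes two different curves at \<open>c\<close>, and the other smoothing fuses
  them.\<close>

lemma card_curves_switch:
  assumes M: "alternating M" and c: "c \<in> classical K"
    and arc: "\<And>x. x \<in> darts K \<Longrightarrow> arc K x \<in> P \<longleftrightarrow> x \<in> P"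
    and base: "\<And>x. x \<in> \<Union>(base_points K) \<Longrightarrow> rot K x \<in> P \<longleftrightarrow> x \<in> P"
    and virt: "\<And>x. x \<in> \<Union>(virt K) \<Longrightarrow> rot K (rot K x) \<in> P \<longleftrightarrow> x \<in> P"
    and joined: "\<And>x. x \<in> \<Union>(classical K) - M \<Longrightarrow> rot K x \<in> P \<longleftrightarrow> x \<in> P"
    and merged: "\<And>x. x \<in> c \<inter> M \<Longrightarrow> rot K x \<in> P \<longleftrightarrow> x \<notin> P"
  shows "card (curves K M) = card (curves K (sym_diff M c)) + 1"
proof -
  have cr: "c \<in> crossings K" and vert: "c \<in> vertices K"
    using c vertex_kinds by auto
  note in_c = rot_in_vertex[OF vert]
  have alt: "rot K u \<in> M \<longleftrightarrow> u \<notin> M" if "u \<in> c" for u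
    using M c that by (auto simp: alternating_def)
  obtain x0 where "x0 \<in> c"
    using cr by (force simp: crossings_def)
  then obtain x where x: "x \<in> c" "x \<in> M"
    using alt[of x0] in_c by metis
  define b y z where "b = rot K x" and "y = rot K b" and "z = rot K y"
  have mem: "b \<in> c" "y \<in> c" "z \<in> c" "b \<notin> M" "y \<in> M" "z \<notin> M"
    using x in_c alt by (auto simp: b_def y_def z_def)
  have c_eq: "c = {x, b, y, z}" and rz: "rot K z = x"
    using crossing_cases(1,3)[OF cr x(1)] by (simp_all add: b_def y_def z_def)
  have rots: "rot K x = b" "rot K b = y" "rot K y = z"
    by (simp_all add: b_def y_def z_def)
  let ?R = "joins (M \<union> c)"
  have joins_M: "joins M = ?R \<union> {(b, y), (z, x)}"
  proof -
    have "\<Union>(classical K) - M = (\<Union>(classical K) - (M \<union> c)) \<union> {b, z}"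
      using c c_eq mem x by auto
    then show ?thesis unfolding joins_def by (auto simp: rots rz)
  qed
  have joins_M': "joins (sym_diff M c) = ?R \<union> {(x, b), (y, z)}"
  proof -
    have "\<Union>(classical K) - sym_diff M c = (\<Union>(classical K) - (M \<union> c)) \<union> {x, y}"
      using c c_eq mem x by auto
    then show ?thesis unfolding joins_def by (auto simp: rots rz)
  qed
  have P_const: "(u \<in> P) = (w \<in> P)" if "(u, w) \<in> linked (M \<union> c)" for u w
    using that
  proof (rule symcl_preserves)
    fix u w assume "(u, w) \<in> joins (M \<union> c)"
    then show "(u \<in> P) = (w \<in> P)"
      using arc base virt joined unfolding joins_def by blast
  qed
  have P: "b \<in> P \<longleftrightarrow> x \<notin> P" "y \<in> P \<longleftrightarrow> b \<in> P" "z \<in> P \<longleftrightarrow> x \<in> P"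
    using merged[of x] joined[of b] joined[of z] x mem c by (auto simp: rots rz)
  \<comment> \<open>Of the other three ends only \<open>z\<close> is on the same side of
    \<open>P\<close> as \<open>x\<close>.\<close>
  have xz: "(x, z) \<in> linked (M \<union> c)"
  proof -
    obtain w where w: "w \<in> c" "w \<noteq> x" "(x, w) \<in> linked (M \<union> c)"
      using loose_end[OF M c x(1)] .
    then have "w = z" using P_const[OF w(3)] P c_eq by auto
    with w show ?thesis by simp
  qed
  have "by": "(b, y) \<in> linked (M \<union> c)"
  proof -
    obtain w where w: "w \<in> c" "w \<noteq> b" "(b, w) \<in> linked (M \<union> c)"
      using loose_end[OF M c mem(1)] .
    then have "w = y" using P_const[OF w(3)] P c_eq by auto
    with w show ?thesis by simp
  qed
  have darts: "x \<in> darts K" "b \<in> darts K"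
    using x mem vertex_darts[OF vert] by auto
  have "linked M = linked (M \<union> c)"
  proof (rule equalityI; rule symcl_mono)
    show "joins M \<subseteq> linked (M \<union> c)"
      unfolding joins_M using "by" linked_sym[OF xz] by auto
    show "joins (M \<union> c) \<subseteq> linked M"
      unfolding joins_M by auto
  qed
  then have "card (curves K M) = card (connected_classes (darts K) ?R)"
    unfolding curves_def joins_def[symmetric] by (metis connected_classes_eqI)
  also have "\<dots> = card (connected_classes (darts K) (insert (x, b) ?R)) + 1"
    by (rule card_connected_classes_insert[OF finite_darts darts])
      (use P_const[of x b] P(1) in blast)
  \<comment> \<open>The second new link, from \<open>y\<close> to \<open>z\<close>, already follows
    from the first one and the two strands outside \<open>c\<close>.\<close>
  also have "connected_classes (darts K) (insert (x, b) ?R) = curves K (sym_diff M c)"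
  proof -
    let ?R' = "insert (x, b) ?R"
    let ?l = "(?R' \<union> ?R'\<inverse>)\<^sup>*"
    have sub: "linked (M \<union> c) \<subseteq> ?l"
      by (rule rtrancl_mono) auto
    have yb: "(y, b) \<in> ?l"
      by (rule subsetD[OF sub linked_sym[OF "by"]])
    have bx: "(b, x) \<in> ?l" by auto
    have yz: "(y, z) \<in> ?l"
      by (rule rtrancl_trans[OF rtrancl_trans[OF yb bx] subsetD[OF sub xz]])
    have "linked (sym_diff M c) = ?l"
      unfolding joins_M' by (intro equalityI symcl_mono) (use yz in auto)
    then show ?thesis
      unfolding curves_def joins_def[symmetric] by (metis connected_classes_eqI)
  qed
  finally show ?thesis .
qed

text \<open>Each vertex or face lies in a piece or misses it, so the parity conditions restrict to
  \<open>X \<inter> Q\<close>. Solutions on different pieces are glued freely, because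
  \<open>arc\<close> and \<open>rot\<close> never leave a piece.\<close>

lemma coboundary:
  assumes X: "X \<subseteq> darts K"
    and vertex: "\<And>v. v \<in> vertices K \<Longrightarrow> even (card (X \<inter> v))"
    and face: "\<And>f. f \<in> faces K \<Longrightarrow> even (card (X \<inter> f))"
  obtains P where "\<And>x. x \<in> darts K \<Longrightarrow> arc K x \<in> P \<longleftrightarrow> x \<in> P"
    "\<And>x. x \<in> darts K \<Longrightarrow> rot K x \<in> P \<longleftrightarrow> (x \<in> P) \<noteq> (x \<in> X)"
proof -
  have "\<exists>P. \<forall>x\<in>Q. (arc K x \<in> P \<longleftrightarrow> x \<in> P) \<and> (x \<in> X \<longleftrightarrow> (x \<in> P) \<noteq> (rot K x \<in> P))"
    if Q: "Q \<in> pieces K" for Q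
  proof -
    have *: "even (card (X \<inter> Q \<inter> w))" if w: "w = orbit f x" and f: "f permutes darts K" "\<And>x. f x \<in> Q \<longleftrightarrow> x \<in> Q"
      and even: "even (card (X \<inter> w))" for f w x
    proof (cases "x \<in> Q")
      case True
      then have "X \<inter> Q \<inter> w = X \<inter> w"
        using orbit_in_piece[OF f, of x] w by blast
      then show ?thesis using even by simp
    next
      case False
      have "Q \<inter> w = {}"
      proof (rule ccontr)
        assume "Q \<inter> w \<noteq> {}"
        then obtain u where "u \<in> Q" "orbit f u = orbit f x"
          using w orbit_eq[OF f(1)] by blast
        then show False
          using orbit_in_piece[OF f] False by metis
      qed
      then show ?thesis by (simp add: Int_assoc)
    qed
    have "even (card (X \<inter> Q \<inter> v))" if "v \<in> vertices K" for v
      using that vertex[OF that] *[OF _ rot_permutes piece_memD(3)[OF Q]]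
      by (auto simp: vertices_def)
    moreover have "even (card (X \<inter> Q \<inter> f))" if "f \<in> faces K" for f
      using that face[OF that] *[OF _ face_step_permutes face_step_in_piece[OF Q]]
      by (auto simp: faces_def)
    ultimately obtain P where "\<And>x. x \<in> Q \<Longrightarrow> arc K x \<in> P \<longleftrightarrow> x \<in> P"
      "\<And>x. x \<in> Q \<Longrightarrow> x \<in> X \<inter> Q \<longleftrightarrow> (x \<in> P) \<noteq> (rot K x \<in> P)"
      using genus_zero_coboundary[OF Q, of "X \<inter> Q"] by blast
    then show ?thesis by (intro exI[of _ P]) auto
  qed
  then obtain P where P: "\<And>Q x. Q \<in> pieces K \<Longrightarrow> x \<in> Q \<Longrightarrow>
      (arc K x \<in> P Q \<longleftrightarrow> x \<in> P Q) \<and> (x \<in> X \<longleftrightarrow> (x \<in> P Q) \<noteq> (rot K x \<in> P Q))"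
    by metis
  let ?p = "\<lambda>x. (adjacency \<union> adjacency\<inverse>)\<^sup>* `` {x}"
  have p: "?p x \<in> pieces K" "x \<in> ?p x" if "x \<in> darts K" for x
    using that by (auto simp: pieces_def adjacency_def connected_classes_def quotient_def)
  have same: "?p (arc K x) = ?p x" "?p (rot K x) = ?p x" if "x \<in> darts K" for x
    using piece_memD[OF p(1)[OF that]] p(2)[OF that] by blast+
  show ?thesis
  proof (rule that[of "{x. x \<in> P (?p x)}"])
    fix x assume x: "x \<in> darts K"
    show "arc K x \<in> {x. x \<in> P (?p x)} \<longleftrightarrow> x \<in> {x. x \<in> P (?p x)}"
      "rot K x \<in> {x. x \<in> P (?p x)} \<longleftrightarrow> (x \<in> {x. x \<in> P (?p x)}) \<noteq> (x \<in> X)"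
      unfolding mem_Collect_eq same[OF x] using P[OF p[OF x]] by blast+
  qed
qed

end

section \<open>Cycles and cocycles of the face graph\<close>

locale shaded_diagram = link_diagram K for K :: "('d, 'r) diagram" +
  fixes S :: "'r set"
  assumes shading: "checkerboard_shading K S"
begin

lemma dark_rot: "x \<in> darts K \<Longrightarrow> region K (rot K x) \<in> S \<longleftrightarrow> region K x \<notin> S"
  using shading by (auto simp: checkerboard_shading_def)

text \<open>\<open>arc K (rot K x)\<close> is the predecessor of \<open>x\<close> under
  \<open>face_step\<close>.\<close>

lemma region_arc_rot:
  assumes "x \<in> darts K"
  shows "region K (arc K (rot K x)) = region K x"
proof -
  have "rot K x \<in> darts K" using assms by (simp add: rot_in)
  then have "arc K (arc K (rot K x)) = rot K x"
    by (rule arc_arc)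
  then have "face_step K (arc K (rot K x)) = x"
    unfolding face_step_def by (simp add: permutes_inverses[OF rot_permutes])
  moreover have "arc K (rot K x) \<in> darts K"
    using assms by (simp add: arc_in rot_in)
  ultimately show ?thesis
    using region_face_step by metis
qed

lemma crossing_corners:
  assumes c: "c \<in> crossings K" and x: "x \<in> c" "region K x \<in> S"
  shows "dark_corners K S c = {x, rot K (rot K x)}"
    and "white_corners K S c = {rot K x, rot K (rot K (rot K x))}"
    and "rot K (rot K x) \<noteq> x" and "rot K (rot K (rot K x)) \<noteq> rot K x"
    and "region K (rot K (rot K x)) \<in> S"
proof -
  note cc = crossing_cases[OF c x(1)]
  have d: "x \<in> darts K"
    using c x(1) vertex_darts vertex_kinds(2) by blast
  have reg: "region K (rot K x) \<notin> S" "region K (rot K (rot K x)) \<in> S"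
    "region K (rot K (rot K (rot K x))) \<notin> S"
    using d x(2) by (simp_all add: dark_rot rot_in)
  then show "region K (rot K (rot K x)) \<in> S" by simp
  show "dark_corners K S c = {x, rot K (rot K x)}"
    unfolding dark_corners_def using cc(1) x(2) reg by blast
  show "white_corners K S c = {rot K x, rot K (rot K (rot K x))}"
    unfolding white_corners_def using cc(1) x(2) reg by blast
  show "rot K (rot K x) \<noteq> x" "rot K (rot K (rot K x)) \<noteq> rot K x"
    using cc(2) by auto
qed

lemma crossing_has_dark:
  assumes "c \<in> crossings K"
  obtains x where "x \<in> c" "region K x \<in> S"
proof -
  obtain x where x: "x \<in> c"
    using assms by (force simp: crossings_def)
  have v: "c \<in> vertices K"
    using assms vertex_kinds(2) by blast
  have "x \<in> darts K"
    using x v vertex_darts by blast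
  then show ?thesis
    using that[of x] that[of "rot K x"] x rot_in_vertex[OF v] dark_rot by blast
qed

lemma mem_cut_face_graph:
  assumes c: "c \<in> crossings K" and x: "x \<in> c" "region K x \<in> S"
  shows "c \<in> cut (face_graph K S) h \<longleftrightarrow> h (region K x) \<noteq> h (region K (rot K (rot K x)))"
proof -
  note cc = crossing_corners[OF c x]
  have ends: "ends (face_graph K S) c = {region K x, region K (rot K (rot K x))}"
    by (simp add: face_graph_def cc(1))
  have "c \<in> edges (face_graph K S)" "region K x \<in> verts (face_graph K S)"
    "region K (rot K (rot K x)) \<in> verts (face_graph K S)"
    using c x(2) cc(5) by (simp_all add: face_graph_def)
  then show ?thesis
    unfolding cut_def mem_Collect_eq ends by (fastforce simp: doubleton_eq_iff)
qed

lemma corner_union_Int_vertex: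
  assumes "F \<subseteq> crossings K" "v \<in> vertices K" and sub: "\<And>c. D c \<subseteq> c"
  shows "(\<Union>(D ` F)) \<inter> v = (if v \<in> F then D v else {})"
proof -
  have "D c \<inter> v = {}" if "c \<in> F" "c \<noteq> v" for c
    using that assms(1,2) sub[of c] vertex_unique[of c v] vertex_kinds(2) by blast
  moreover have "D v \<inter> v = D v" using sub[of v] by blast
  ultimately show ?thesis by auto
qed

lemma corners_subset: "dark_corners K S c \<subseteq> c" "white_corners K S c \<subseteq> c"
  by (auto simp: dark_corners_def white_corners_def)

lemma card_corners:
  assumes "c \<in> crossings K"
  shows "card (dark_corners K S c) = 2" "card (white_corners K S c) = 2"
proof -
  obtain x where "x \<in> c" "region K x \<in> S"
    using crossing_has_dark[OF assms] .
  note cc = crossing_corners[OF assms this]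
  show "card (dark_corners K S c) = 2" "card (white_corners K S c) = 2"
    unfolding cc(1,2) using cc(3,4) by auto
qed

lemma even_corners_vertex:
  assumes "F \<subseteq> crossings K" "v \<in> vertices K"
  shows "even (card (\<Union>(dark_corners K S ` F) \<inter> v))"
    and "even (card (\<Union>(white_corners K S ` F) \<inter> v))"
  using assms card_corners by (auto simp: corner_union_Int_vertex corners_subset)

lemma face_region:
  assumes "x \<in> darts K" "y \<in> orbit (face_step K) x"
  shows "region K y = region K x"
  using assms(2)
proof induction
  case base
  then show ?case using region_face_step[OF assms(1)] .
next
  case (step y)
  then have "y \<in> darts K"
    using orbit_darts[OF face_step_permutes assms(1)] by blast
  then show ?case using region_face_step step.IH by simp
qed

text \<open>
  A cycle of the face graph is a closed walk in the nesting tree, alternating between regions and the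
  pieces of its crossings; such a walk uses every edge of the tree an even number of times.
\<close>

lemma even_dark_corners_face:
  assumes cyc: "is_cycle (face_graph K S) F" and f: "f \<in> faces K"
  shows "even (card (\<Union>(dark_corners K S ` F) \<inter> f))"
proof -
  have F: "F \<subseteq> crossings K"
    using cyc by (auto simp: is_cycle_def face_graph_def)
  have finF: "finite F"
    using F finite_crossings by (rule finite_subset)
  let ?p = "\<lambda>x. (adjacency \<union> adjacency\<inverse>)\<^sup>* `` {x}"
  let ?f = "orbit (face_step K)"
  have p: "?p x \<in> pieces K" "x \<in> ?p x" if "x \<in> darts K" for x
    using that by (auto simp: pieces_def adjacency_def connected_classes_def quotient_def)
  have ends: "ends (nesting_graph K) (?f x) = {Inl (?p x), Inr (region K x)}"
    if x: "x \<in> darts K" for x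
  proof -
    have "{Q \<in> pieces K. ?f x \<subseteq> Q} = {?p x}"
    proof -
      have "?f x \<subseteq> Q \<longleftrightarrow> Q = ?p x" if Q: "Q \<in> pieces K" for Q
        using orbit_in_piece[OF face_step_permutes face_step_in_piece[OF Q], of x]
          piece_memD(4)[OF Q, of x] p(2)[OF x] by metis
      then show ?thesis using p(1)[OF x] by blast
    qed
    moreover have "region K ` ?f x = (\<lambda>_. region K x) ` ?f x"
      by (intro image_cong refl face_region[OF x])
    then have "region K ` ?f x = {region K x}"
      by (simp only: image_constant_conv orbit_nonempty if_False)
    ultimately show ?thesis
      by (simp add: nesting_graph_def insert_commute)
  qed
  have verts: "Inl (?p x) \<in> verts (nesting_graph K)" "Inr (region K x) \<in> verts (nesting_graph K)"
    and edges: "?f x \<in> edges (nesting_graph K)" if "x \<in> darts K" for x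
    using that p(1)[OF that] by (simp_all add: nesting_graph_def regions_def faces_def)
  obtain x0 where x0: "x0 \<in> darts K" "f = ?f x0"
    using f by (auto simp: faces_def)
  \<comment> \<open>\<open>W\<close> is one side of the nesting tree after removal of the edge
    \<open>f\<close>, so \<open>f\<close> is the only face whose piece and region lie on different
    sides.\<close>
  obtain W where W: "W (Inl (?p x0))" "\<not> W (Inr (region K x0))"
    "\<And>e u v. e \<in> edges (nesting_graph K) \<Longrightarrow> e \<noteq> f \<Longrightarrow> ends (nesting_graph K) e = {u, v} \<Longrightarrow>
      u \<in> verts (nesting_graph K) \<Longrightarrow> v \<in> verts (nesting_graph K) \<Longrightarrow> W u = W v"
    using acyclic_edge_cut[of "nesting_graph K" f "Inl (?p x0)" "Inr (region K x0)"]
      tree edges[OF x0(1)] ends[OF x0(1)] verts[OF x0(1)] unfolding is_tree_def x0(2) by blast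
  have W_iff: "x \<in> f \<longleftrightarrow> W (Inl (?p x)) \<noteq> W (Inr (region K x))" if x: "x \<in> darts K" for x
  proof (cases "?f x = f")
    case True
    then have "x \<in> f"
      using orbit_self[OF face_step_permutes, of x] by simp
    have "ends (nesting_graph K) f = {Inl (?p x), Inr (region K x)}"
      using ends[OF x] True by simp
    then have "{Inl (?p x), Inr (region K x)} = {Inl (?p x0), Inr (region K x0)}"
      using ends[OF x0(1)] x0(2) by metis
    then have "Inl (?p x) = Inl (?p x0)" "Inr (region K x) = Inr (region K x0)"
      unfolding doubleton_eq_iff by blast+
    then show ?thesis
      using W(1,2) \<open>x \<in> f\<close> by metis
  next
    case False
    then have "x \<notin> f"
      using orbit_eq[OF face_step_permutes] x0(2) by blast
    then show ?thesis
      using W(3)[OF edges[OF x] False ends[OF x] verts[OF x]] by blast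
  qed
  \<comment> \<open>Both dark corners of a crossing lie in the same piece, so exactly one of them is
    on \<open>f\<close> if and only if \<open>W\<close> differs on their two regions. This reduces
    the claim to a cycle meeting a cut.\<close>
  have odd_iff: "odd (card (dark_corners K S c \<inter> f)) \<longleftrightarrow>
      c \<in> cut (face_graph K S) (\<lambda>r. W (Inr r))" if "c \<in> F" for c
  proof -
    have c: "c \<in> crossings K" using that F by blast
    then obtain x where x: "x \<in> c" "region K x \<in> S"
      using crossing_has_dark by blast
    note cc = crossing_corners[OF c x]
    let ?y = "rot K (rot K x)"
    have d: "x \<in> darts K" "?y \<in> darts K"
      using c x(1) vertex_darts vertex_kinds(2) rot_in by blast+
    have "?y \<in> ?p x"
      using piece_memD(3)[OF p(1)[OF d(1)]] p(2)[OF d(1)] by blast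
    then have "?p ?y = ?p x"
      using piece_memD(4)[OF p(1)[OF d(1)]] by metis
    then have "(x \<in> f) \<noteq> (?y \<in> f) \<longleftrightarrow> W (Inr (region K x)) \<noteq> W (Inr (region K ?y))"
      using W_iff[OF d(1)] W_iff[OF d(2)] by auto
    moreover have "odd (card ({x, ?y} \<inter> f)) \<longleftrightarrow> (x \<in> f) \<noteq> (?y \<in> f)"
      using cc(3) by (cases "x \<in> f"; cases "?y \<in> f") auto
    ultimately show ?thesis
      unfolding cc(1) mem_cut_face_graph[OF c x] by blast
  qed
  have "card (\<Union>(dark_corners K S ` F) \<inter> f) = card (\<Union>c\<in>F. dark_corners K S c \<inter> f)"
    by (rule arg_cong[where f = card]) blast
  also have "\<dots> = (\<Sum>c\<in>F. card (dark_corners K S c \<inter> f))"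
  proof (rule card_UN_disjoint[OF finF])
    show "\<forall>c\<in>F. finite (dark_corners K S c \<inter> f)"
      using F finite_vertex vertex_kinds(2) corners_subset(1) by (meson finite_Int finite_subset subsetD)
    show "\<forall>c\<in>F. \<forall>c'\<in>F. c \<noteq> c' \<longrightarrow> dark_corners K S c \<inter> f \<inter> (dark_corners K S c' \<inter> f) = {}"
      using F vertex_unique vertex_kinds(2) corners_subset(1) by blast
  qed
  finally have "even (card (\<Union>(dark_corners K S ` F) \<inter> f)) \<longleftrightarrow>
      even (card {c \<in> F. odd (card (dark_corners K S c \<inter> f))})"
    using finF by (simp add: even_sum_iff)
  also have "{c \<in> F. odd (card (dark_corners K S c \<inter> f))} =
      F \<inter> cut (face_graph K S) (\<lambda>r. W (Inr r))"
    using odd_iff by blast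
  finally show ?thesis
    using even_card_cycle_inter_cut[OF cyc] by simp
qed

text \<open>Along a white face, the dark region across the boundary stays the same at base points,
  and at a crossing it passes from one end of the corresponding edge to the other. The corners in
  question are therefore the changes of \<open>h\<close> along a closed walk; a dark face contains
  none of them.\<close>

lemma even_white_corners_face:
  assumes f: "f \<in> faces K"
  shows "even (card (\<Union>(white_corners K S ` cut (face_graph K S) h) \<inter> f))"
proof -
  let ?F = "cut (face_graph K S) h"
  have F: "?F \<subseteq> crossings K"
    by (auto simp: cut_def face_graph_def)
  obtain x0 where x0: "x0 \<in> darts K" "f = orbit (face_step K) x0"
    using f by (auto simp: faces_def)
  have f_darts: "f \<subseteq> darts K"
    unfolding x0(2) by (rule orbit_darts[OF face_step_permutes x0(1)])
  then have finf: "finite f"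
    using finite_darts by (rule finite_subset)
  have reg: "region K y = region K x0" if "y \<in> f" for y
    using that face_region[OF x0(1)] x0(2) by blast
  show ?thesis
  proof (cases "region K x0 \<in> S")
    case True
    then have "\<Union>(white_corners K S ` ?F) \<inter> f = {}"
      using reg by (auto simp: white_corners_def)
    then show ?thesis by (metis card.empty even_zero)
  next
    case False
    let ?u = "\<lambda>y. h (region K (rot K y))"
    have "y \<in> \<Union>(white_corners K S ` ?F) \<longleftrightarrow> ?u y \<noteq> ?u (face_step K y)" if y: "y \<in> f" for y
    proof -
      define v where "v = orbit (rot K) y"
      have yd: "y \<in> darts K" using y f_darts by blast
      have v: "v \<in> vertices K" "y \<in> v"
        using vertex_of[OF yd] orbit_self[OF rot_permutes] by (auto simp: v_def)
      have white: "region K y \<notin> S" using reg[OF y] False by simp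
      have mem: "y \<in> \<Union>(white_corners K S ` ?F) \<longleftrightarrow> v \<in> ?F"
      proof -
        have "y \<in> \<Union>(white_corners K S ` ?F) \<longleftrightarrow> y \<in> \<Union>(white_corners K S ` ?F) \<inter> v"
          using v(2) by blast
        also have "\<dots> \<longleftrightarrow> v \<in> ?F"
          using v(2) white unfolding corner_union_Int_vertex[OF F v(1) corners_subset(2)]
          by (simp add: white_corners_def)
        finally show ?thesis .
      qed
      have next_face: "rot K (face_step K y) = arc K y" by (rule rot_face_step)
      consider "v \<in> base_points K" | "v \<in> crossings K"
        using v(1) vertex_kinds(3,5,8) virt_crossings by blast
      then show ?thesis
      proof cases
        case 1
        have "region K (arc K (rot K (rot K y))) = region K (rot K y)"
          by (rule region_arc_rot) (simp add: rot_in yd)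
        then have "region K (arc K y) = region K (rot K y)"
          using base_point_cases(3)[OF 1 v(2)] by simp
        moreover have "v \<notin> ?F" using 1 F vertex_kinds(6) by blast
        ultimately show ?thesis using mem next_face by simp
      next
        case 2
        have in_v: "rot K y \<in> v"
          using v rot_in_vertex by blast
        have dark: "region K (rot K y) \<in> S"
          using white dark_rot[OF yd] by blast
        have "region K (arc K (rot K (rot K (rot K (rot K y))))) = region K (rot K (rot K (rot K y)))"
          by (rule region_arc_rot) (simp add: rot_in yd)
        then have "region K (arc K y) = region K (rot K (rot K (rot K y)))"
          using crossing_cases(3)[OF 2 v(2)] by simp
        then show ?thesis
          unfolding mem next_face using mem_cut_face_graph[OF 2 in_v dark] by simp
      qed
    qed
    then have "\<Union>(white_corners K S ` ?F) \<inter> f = {y \<in> f. ?u y \<noteq> ?u (face_step K y)}"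
      by blast
    moreover have "bij_betw (face_step K) f f"
      unfolding x0(2) by (rule orbit_bij[OF face_step_permutes])
    ultimately show ?thesis
      using even_card_changes[OF finf, of "face_step K" ?u] by simp
  qed
qed

section \<open>From corner systems to the change of the zero order\<close>

definition merged_corners :: "'d set set \<Rightarrow> 'd set" where
  "merged_corners B = \<Union>(dark_corners K S ` B) \<union> \<Union>(white_corners K S ` (classical K - B))"

lemma zero_order_merged: "zero_order K S B = card (curves K (merged_corners B))"
  by (simp add: zero_order_def merged_corners_def)

lemma mem_merged_corners:
  assumes "B \<subseteq> classical K" "c \<in> classical K" "x \<in> c"
  shows "x \<in> merged_corners B \<longleftrightarrow> (region K x \<in> S \<longleftrightarrow> c \<in> B)"
proof -
  have "c' = c" if "c' \<in> classical K" "x \<in> c'" for c'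
    using vertex_unique[of c' c x] that assms(2,3) vertex_kinds(4) by blast
  then show ?thesis
    using assms unfolding merged_corners_def dark_corners_def white_corners_def by blast
qed

lemma merged_corners_subset: "B \<subseteq> classical K \<Longrightarrow> merged_corners B \<subseteq> \<Union>(classical K)"
  unfolding merged_corners_def dark_corners_def white_corners_def by blast

lemma alternating_merged_corners:
  assumes "B \<subseteq> classical K"
  shows "alternating (merged_corners B)"
  unfolding alternating_def
proof
  fix x assume "x \<in> \<Union>(classical K)"
  then obtain c where c: "c \<in> classical K" "x \<in> c" by blast
  then have v: "c \<in> vertices K" using vertex_kinds(4) by blast
  have "rot K x \<in> c" using rot_in_vertex[OF v] c(2) by blast
  moreover have "x \<in> darts K" using vertex_darts[OF v] c(2) by blast
  ultimately show "x \<in> merged_corners B \<longleftrightarrow> rot K x \<notin> merged_corners B"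
    using mem_merged_corners[OF assms c(1)] c(2) dark_rot by blast
qed

text \<open>Both directions are recorded because the state with one more curve contains
  \<open>e\<close> in the loop case and omits it in the bridge case.\<close>

lemma merged_corners_insert:
  assumes "B \<subseteq> classical K" "e \<in> classical K" "e \<notin> B"
  shows "merged_corners (insert e B) = sym_diff (merged_corners B) e"
    and "merged_corners B = sym_diff (merged_corners (insert e B)) e"
proof -
  have B': "insert e B \<subseteq> classical K" using assms by blast
  have "x \<in> merged_corners (insert e B) \<longleftrightarrow> (x \<in> merged_corners B) \<noteq> (x \<in> e)" for x
  proof (cases "x \<in> \<Union>(classical K)")
    case True
    then obtain c where c: "c \<in> classical K" "x \<in> c" by blast
    have "x \<in> e \<longleftrightarrow> c = e"
      using c assms(2) vertex_unique[of c e x] vertex_kinds(4) by blast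
    then show ?thesis
      using mem_merged_corners[OF assms(1) c] mem_merged_corners[OF B' c] assms(3) by blast
  next
    case False
    then show ?thesis
      using merged_corners_subset[OF assms(1)] merged_corners_subset[OF B'] assms(2) by blast
  qed
  then show "merged_corners (insert e B) = sym_diff (merged_corners B) e"
    "merged_corners B = sym_diff (merged_corners (insert e B)) e" by blast+
qed

text \<open>
  \<open>X\<close> consists of the corners through which a system of closed curves passes; it meets the diagram
  only in crossings, so \<open>coboundary\<close> provides the set of darts inside these curves.
\<close>

lemma card_curves_corner_system:
  assumes M: "alternating M" and e: "e \<in> classical K"
    and X: "X \<subseteq> \<Union>(classical K)" "X \<subseteq> M" "e \<inter> M \<subseteq> X"
    and vertex: "\<And>v. v \<in> vertices K \<Longrightarrow> even (card (X \<inter> v))"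
    and face: "\<And>f. f \<in> faces K \<Longrightarrow> even (card (X \<inter> f))"
  shows "card (curves K M) = card (curves K (sym_diff M e)) + 1"
proof -
  have darts: "\<Union>W \<subseteq> darts K" if "W \<subseteq> vertices K" for W
    using that vertex_darts by blast
  have "X \<subseteq> darts K" using X(1) darts[OF vertex_kinds(4)] by blast
  then obtain P where P: "\<And>x. x \<in> darts K \<Longrightarrow> arc K x \<in> P \<longleftrightarrow> x \<in> P"
    "\<And>x. x \<in> darts K \<Longrightarrow> rot K x \<in> P \<longleftrightarrow> (x \<in> P) \<noteq> (x \<in> X)"
    using coboundary[OF _ vertex face] by blast
  have off: "x \<notin> X" if "v \<in> vertices K" "v \<notin> classical K" "x \<in> v" for x v
    using that X(1) vertex_unique[OF that(1)] vertex_kinds(4) by blast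
  have P_rot: "rot K x \<in> P \<longleftrightarrow> x \<in> P" if "x \<in> darts K" "x \<notin> X" for x
    using P(2)[OF that(1)] that(2) by blast
  show ?thesis
  proof (rule card_curves_switch[OF M e P(1)])
    fix x assume "x \<in> \<Union>(base_points K)"
    then obtain v where v: "x \<in> v" "v \<in> base_points K" by blast
    then have v': "v \<in> vertices K" "v \<notin> classical K"
      using vertex_kinds(1,5,6) by blast+
    show "rot K x \<in> P \<longleftrightarrow> x \<in> P"
      by (rule P_rot[OF subsetD[OF vertex_darts[OF v'(1)] v(1)] off[OF v' v(1)]])
  next
    \<comment> \<open>A strand running straight through passes two corners, neither of them in
      \<open>X\<close>, so it stays on one side of \<open>P\<close>.\<close>
    fix x assume "x \<in> \<Union>(virt K)"
    then obtain v where v: "x \<in> v" "v \<in> virt K" by blast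
    then have v': "v \<in> vertices K" "v \<notin> classical K"
      using vertex_kinds(3,7) by blast+
    have rv: "rot K x \<in> v" using rot_in_vertex[OF v'(1)] v(1) by blast
    show "rot K (rot K x) \<in> P \<longleftrightarrow> x \<in> P"
      using P_rot[OF subsetD[OF vertex_darts[OF v'(1)] v(1)] off[OF v' v(1)]]
        P_rot[OF subsetD[OF vertex_darts[OF v'(1)] rv] off[OF v' rv]] by (rule trans[rotated])
  next
    fix x assume x: "x \<in> \<Union>(classical K) - M"
    then have "x \<in> darts K" "x \<notin> X"
      using X(2) darts[OF vertex_kinds(4)] by blast+
    then show "rot K x \<in> P \<longleftrightarrow> x \<in> P"
      by (rule P_rot)
  next
    fix x assume "x \<in> e \<inter> M"
    then have "x \<in> darts K" "x \<in> X"
      using X(3) e darts[OF vertex_kinds(4)] by blast+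
    then show "rot K x \<in> P \<longleftrightarrow> x \<notin> P"
      using P(2)[of x] by blast
  qed
qed

text \<open>The curve system runs through the dark corners of the cycle, all merged once
  \<open>e\<close> is added. Each crossing of the cycle contributes two corners at its vertex;
  evenness on faces comes from the nesting tree.\<close>

lemma zero_order_loop:
  assumes B: "B \<subseteq> classical K" and e: "e \<in> classical K" "e \<notin> B"
    and cyc: "is_cycle (face_graph K S) F" and F: "F \<subseteq> insert e B" "e \<in> F"
  shows "zero_order K S (insert e B) = zero_order K S B + 1"
proof -
  let ?X = "\<Union>(dark_corners K S ` F)"
  have B': "insert e B \<subseteq> classical K" using B e by blast
  then have Fc: "F \<subseteq> classical K" using F by blast
  then have Fcr: "F \<subseteq> crossings K" using vertex_kinds(5) by blast
  have X: "?X \<subseteq> \<Union>(classical K)"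
    using Fc corners_subset(1) by blast
  have "card (curves K (merged_corners (insert e B))) =
      card (curves K (sym_diff (merged_corners (insert e B)) e)) + 1"
  proof (rule card_curves_corner_system[OF alternating_merged_corners[OF B'] e(1) X])
    show "?X \<subseteq> merged_corners (insert e B)"
      using F(1) unfolding merged_corners_def by blast
    show "e \<inter> merged_corners (insert e B) \<subseteq> ?X"
    proof
      fix x assume "x \<in> e \<inter> merged_corners (insert e B)"
      then have "x \<in> dark_corners K S e"
        using mem_merged_corners[OF B' e(1), of x] by (simp add: dark_corners_def)
      then show "x \<in> ?X" using F(2) by blast
    qed
  qed (use even_corners_vertex(1)[OF Fcr] even_dark_corners_face[OF cyc] in blast)+
  then show ?thesis
    by (simp only: zero_order_merged merged_corners_insert(2)[OF B e, symmetric])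
qed

text \<open>The curves now run through white corners, those of a cut inside the cocycle that still
  contains \<open>e\<close>. They are all merged as long as \<open>e\<close> is not in
  \<open>B\<close>.\<close>

lemma zero_order_bridge:
  assumes B: "B \<subseteq> classical K" and e: "e \<in> classical K" "e \<notin> B"
    and coc: "is_cocycle (face_graph K S) F" and F: "F \<subseteq> classical K - B" "e \<in> F"
  shows "zero_order K S B = zero_order K S (insert e B) + 1"
proof -
  obtain h where h: "e \<in> cut (face_graph K S) h" "cut (face_graph K S) h \<subseteq> F"
    using cocycle_contains_cut[OF coc F(2)] .
  let ?F = "cut (face_graph K S) h"
  let ?X = "\<Union>(white_corners K S ` ?F)"
  have Fc: "?F \<subseteq> classical K - B" using h F by blast
  then have Fcr: "?F \<subseteq> crossings K" using vertex_kinds(5) by blast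
  have X: "?X \<subseteq> \<Union>(classical K)"
    using Fc corners_subset(2) by blast
  have "card (curves K (merged_corners B)) = card (curves K (sym_diff (merged_corners B) e)) + 1"
  proof (rule card_curves_corner_system[OF alternating_merged_corners[OF B] e(1) X])
    show "?X \<subseteq> merged_corners B"
      using Fc unfolding merged_corners_def by blast
    show "e \<inter> merged_corners B \<subseteq> ?X"
    proof
      fix x assume "x \<in> e \<inter> merged_corners B"
      then have "x \<in> white_corners K S e"
        using mem_merged_corners[OF B e(1), of x] e(2) by (simp add: white_corners_def)
      then show "x \<in> ?X" using h(1) by blast
    qed
  qed (use even_corners_vertex(2)[OF Fcr] even_white_corners_face in blast)+
  then show ?thesis
    by (simp only: zero_order_merged merged_corners_insert(1)[OF B e, symmetric])
qed

lemma zero_order_pos: "0 < zero_order K S B"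
proof -
  have "finite (curves K M)" "curves K M \<noteq> {}" for M
    using finite_darts darts_nonempty
    by (simp_all add: curves_def connected_classes_def quotient_def)
  then show ?thesis by (simp add: zero_order_merged card_gt_0_iff)
qed

end

section \<open>The Kauffman bracket\<close>

lemma A_pow_mult: "A_pow a * A_pow b = A_pow (a + b)"
  by (simp add: A_pow_def mult_single)

lemma A_pow_0: "A_pow 0 = 1"
  by (simp add: A_pow_def)

lemma A_pow_power: "A_pow a ^ n = A_pow (a * int n)"
  by (induction n) (simp_all add: A_pow_0 A_pow_mult distrib_left)

text \<open>The origin of the cubes: \<open>A + A^{-1} d = -A^{-3}\<close> and
  \<open>A d + A^{-1} = -A^3\<close> for \<open>Plus\<close>; \<open>Minus\<close> exchanges
  \<open>A\<close> and its inverse.\<close>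

lemma kauffman_active:
  "kauffman_substitution (X_act c) = kauffman_substitution (X_inact c) +
     kauffman_substitution (Y_inact c) * kauffman_substitution D_var"
  "kauffman_substitution (Y_act c) = kauffman_substitution (X_inact c) * kauffman_substitution D_var +
     kauffman_substitution (Y_inact c)"
  by (cases c; simp add: A_pow_mult algebra_simps; fail)+

context shaded_diagram
begin

section \<open>Dark and white corners versus A- and B-corners\<close>

lemma regular_edges: "edges (face_graph K S) - virt K = classical K"
  by (simp add: face_graph_def classical_def)

lemma white_eq_Diff: "white_corners K S c = c - dark_corners K S c"
  by (auto simp: white_corners_def dark_corners_def)

lemma B_eq_Diff: "B_corners K c = c - A_corners K c"
  by (auto simp: A_corners_def B_corners_def)

text \<open>\<open>Minus\<close> is merely the default case of \<open>edge_color\<close>. Dark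
  corners and A-corners are both opposite pairs at the crossing, so if they are not equal they are
  complementary.\<close>

lemma colored_corners:
  assumes c: "c \<in> classical K"
  shows "edge_color K S c = Plus \<Longrightarrow> dark_corners K S c = A_corners K c \<and> white_corners K S c = B_corners K c"
    and "edge_color K S c = Minus \<Longrightarrow> dark_corners K S c = B_corners K c \<and> white_corners K S c = A_corners K c"
proof -
  show "dark_corners K S c = A_corners K c \<and> white_corners K S c = B_corners K c"
    if "edge_color K S c = Plus"
    using that by (auto simp: edge_color_def white_eq_Diff B_eq_Diff split: if_splits)
  assume "edge_color K S c = Minus"
  then have ne: "dark_corners K S c \<noteq> A_corners K c"
    by (auto simp: edge_color_def)
  have cr: "c \<in> crossings K" and v: "c \<in> vertices K"
    using c vertex_kinds(4,5) by blast+
  obtain x where x: "x \<in> c" "region K x \<in> S"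
    using crossing_has_dark[OF cr] .
  let ?b = "rot K x"
  let ?y = "rot K ?b"
  let ?z = "rot K ?y"
  note cc = crossing_corners[OF cr x]
  have c_eq: "c = {x, ?b, ?y, ?z}" by (rule crossing_cases(1)[OF cr x(1)])
  have "?b \<in> c" "?y \<in> c" using c_eq by blast+
  then have over: "?b \<in> over K \<longleftrightarrow> x \<notin> over K" "?y \<in> over K \<longleftrightarrow> x \<in> over K"
    "?z \<in> over K \<longleftrightarrow> x \<notin> over K"
    using over_alternates[of x] over_alternates[of ?b] over_alternates[of ?y] x(1) c by blast+
  have "x \<notin> over K"
  proof
    assume "x \<in> over K"
    then have "A_corners K c = {x, ?y}"
      unfolding A_corners_def using over c_eq by blast
    with ne cc(1) show False by blast
  qed
  then have "A_corners K c = {?b, ?z}" "B_corners K c = {x, ?y}"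
    unfolding A_corners_def B_corners_def using over c_eq by blast+
  then show "dark_corners K S c = B_corners K c \<and> white_corners K S c = A_corners K c"
    using cc(1,2) by blast
qed

text \<open>The crossings where state \<open>s\<close> merges dark regions: A-smoothed ones of color
  \<open>Plus\<close> and B-smoothed ones of color \<open>Minus\<close>. Written as an equivalence,
  the map is visibly an involution on subsets of \<open>classical K\<close>.\<close>

definition dark_merges :: "'d set set \<Rightarrow> 'd set set" where
  "dark_merges s = {c \<in> classical K. c \<in> s \<longleftrightarrow> edge_color K S c = Plus}"

lemma bij_dark_merges: "bij_betw dark_merges (Pow (classical K)) (Pow (classical K))"
  by (rule bij_betw_byWitness[where f' = dark_merges]) (auto simp: dark_merges_def)

lemma state_curves_eq:
  assumes "s \<subseteq> classical K"
  shows "state_curves K s = curves K (merged_corners (dark_merges s))"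
proof -
  have eq: "(if c \<in> s then A_corners K c else B_corners K c) =
      (if c \<in> dark_merges s then dark_corners K S c else white_corners K S c)"
    if c: "c \<in> classical K" for c
    using colored_corners[OF c] c by (cases "edge_color K S c") (auto simp: dark_merges_def)
  have "\<Union>(A_corners K ` s) \<union> \<Union>(B_corners K ` (classical K - s)) =
      (\<Union>c\<in>classical K. if c \<in> s then A_corners K c else B_corners K c)"
    using assms by (auto split: if_splits)
  also have "\<dots> = (\<Union>c\<in>classical K. if c \<in> dark_merges s then dark_corners K S c else white_corners K S c)"
    by (rule SUP_cong[OF refl eq])
  also have "\<dots> = merged_corners (dark_merges s)"
    unfolding merged_corners_def by (auto simp: dark_merges_def split: if_splits)
  finally show ?thesis
    by (simp add: state_curves_def)
qed

lemma finite_classical: "finite (classical K)"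
  using finite_crossings by (simp add: classical_def)

text \<open>The color enters twice and cancels: at a \<open>Minus\<close> crossing the inactive
  weights are exchanged, and so is the smoothing that merges the dark regions.\<close>

lemma state_weight:
  assumes "s \<subseteq> classical K"
  shows "(\<Prod>e\<in>classical K. if e \<in> dark_merges s then kauffman_substitution (X_inact (edge_color K S e))
      else kauffman_substitution (Y_inact (edge_color K S e))) =
    A_pow (int (card s) - int (card (classical K - s)))"
proof -
  have "(\<Prod>e\<in>classical K. if e \<in> dark_merges s then kauffman_substitution (X_inact (edge_color K S e))
      else kauffman_substitution (Y_inact (edge_color K S e))) =
      (\<Prod>e\<in>classical K. if e \<in> s then A_pow 1 else A_pow (- 1))"
  proof (rule prod.cong[OF refl])
    fix e assume "e \<in> classical K"
    then show "(if e \<in> dark_merges s then kauffman_substitution (X_inact (edge_color K S e))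
        else kauffman_substitution (Y_inact (edge_color K S e))) = (if e \<in> s then A_pow 1 else A_pow (- 1))"
      by (cases "edge_color K S e") (simp_all add: dark_merges_def)
  qed
  also have "\<dots> = A_pow 1 ^ card s * A_pow (- 1) ^ card (classical K - s)"
    using assms finite_classical by (simp add: prod.If_cases Int_absorb1 Diff_eq)
  also have "\<dots> = A_pow (int (card s) - int (card (classical K - s)))"
    by (simp add: A_pow_power A_pow_mult)
  finally show ?thesis .
qed

lemma kauffman_bracket_eq:
  "kauffman_bracket K = (\<Sum>B\<in>Pow (classical K).
     (\<Prod>e\<in>classical K. if e \<in> B then kauffman_substitution (X_inact (edge_color K S e))
        else kauffman_substitution (Y_inact (edge_color K S e))) *
     kauffman_substitution D_var ^ (zero_order K S B - 1))" (is "_ = sum ?g _")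
proof -
  have d: "kauffman_d = kauffman_substitution D_var"
    by (simp add: kauffman_d_def)
  have "kauffman_bracket K = (\<Sum>s\<in>Pow (classical K). ?g (dark_merges s))"
    unfolding kauffman_bracket_def
  proof (rule sum.cong[OF refl])
    fix s assume "s \<in> Pow (classical K)"
    then have "s \<subseteq> classical K" by simp
    from state_weight[OF this] state_curves_eq[OF this]
    show "A_pow (int (card s) - int (card (classical K - s))) *
        kauffman_d ^ (card (state_curves K s) - 1) = ?g (dark_merges s)"
      by (simp only: d zero_order_merged)
  qed
  also have "\<dots> = sum ?g (Pow (classical K))"
    by (rule sum.reindex_bij_betw[OF bij_dark_merges])
  finally show ?thesis .
qed

end

theorem theorem5p4:
  fixes K :: "('d, 'r) diagram" and S :: "'r set" and \<phi> :: "'d set \<Rightarrow> nat"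
  assumes "virtual_link_diagram K"
    and "checkerboard_shading K S"
    and "proper_labeling (face_graph K S) (virt K) \<phi>"
  shows "substitute kauffman_substitution (diagram_tutte K S \<phi>) = kauffman_bracket K"
proof -
  interpret shaded_diagram K S
    by unfold_locales (rule assms)+
  let ?\<rho> = kauffman_substitution and ?c = "edge_color K S"
  interpret activity_expansion "face_graph K S" "virt K" \<phi>
    "\<lambda>e. ?\<rho> (X_act (?c e))" "\<lambda>e. ?\<rho> (X_inact (?c e))" "\<lambda>e. ?\<rho> (Y_act (?c e))"
    "\<lambda>e. ?\<rho> (Y_inact (?c e))" "?\<rho> D_var" "zero_order K S"
  proof (unfold_locales, unfold regular_edges)
    show "finite (classical K)" by (rule finite_classical)
    show "inj_on \<phi> (classical K)"
      using assms(3) by (simp add: proper_labeling_def regular_edges)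
  qed (rule zero_order_pos zero_order_loop zero_order_bridge kauffman_active; assumption?)+
  \<comment> \<open>Substitution commutes with the choice among the four variables, so
    \<open>weight\<close> is the evaluated Tutte weight and the expansion applies directly.\<close>
  have "?\<rho> (tutte_weight (face_graph K S) (virt K) ?c \<phi> C e) = weight C e" for C e
    by (simp add: tutte_weight_def weight_def)
  then have "substitute ?\<rho> (diagram_tutte K S \<phi>) =
      (\<Sum>C\<in>contracting_sets (face_graph K S) (virt K).
        (\<Prod>e\<in>classical K. weight C e) * ?\<rho> D_var ^ (zero_order K S C - 1))"
    by (simp only: diagram_tutte_def relative_tutte_def substitute_sum substitute_mult substitute_prod
        substitute_power substitute_mvar regular_edges)
  also have "\<dots> = kauffman_bracket K"
    unfolding kauffman_bracket_eq using tutte_expansion by (simp only: regular_edges)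
  finally show ?thesis .
qed

end
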